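(* Let $\gamma>0$ with $\gamma^2<2\ln 2$ and let $\mu$ be the dyadic lognormal multiplicative cascade measure on $[0,1]$ with parameter $\gamma$. If $0<\eta<\frac{\gamma^2}{\gamma^2+2\ln 2}$, then for all $R>0$, $$\lim_{n\to\infty}\mathbb{P}\Big(\max_{y\in[0,1)}\frac{\mu(I_n(y))}{\mu(I_{n+1}(y))^{1-\eta}}\ge R\Big)=1 .$$
   Context: For $n\ge1$ and $k=0,\dots,2^n-1$ let $I_n^k=[\frac{k}{2^n},\frac{k+1}{2^n})$, and for $x\in[0,1)$ let $I_n(x)$ be the unique interval among the $(I_n^k)_{0\le k<2^n}$ containing $x$. Write $x=\sum_{k\ge1}x_k2^{-k}$ with $x_k\in\{0,1\}$ for the dyadic expansion of $x$, and $\pi_n(x)=\sum_{k=1}^n x_k2^{-k}$, the left endpoint of $I_n(x)$. Attach to each dyadic interval of each level $n\ge1$ (indexed by the pair consisting of the level $n$ and its left endpoint) an independent standard Gaussian random variable, and denote by $X_{\pi_n(x)}$ the variable attached to the level-$n$ interval $I_n(x)$. The multiplicative cascade measure $\mu$ is the (almost sure, weak) limit $$\mu(dx)=\lim_{n\to\infty}e^{\gamma X_{\pi_1(x)}+\cdots+\gamma X_{\pi_n(x)}-\frac{\gamma^2}{2}n}\,dx .$$ *)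

theory Defs
  imports "HOL-Probability.Probability"
begin

definition dyadic_interval :: "nat \<Rightarrow> nat \<Rightarrow> real set" where
  "dyadic_interval n k = {real k / 2 ^ n ..< (real k + 1) / 2 ^ n}"

definition dyadic_interval_of :: "nat \<Rightarrow> real \<Rightarrow> real set" where
  "dyadic_interval_of n x = (THE I. x \<in> I \<and> (\<exists>k<2 ^ n. I = dyadic_interval n k))"

text \<open>The digits of the dyadic expansion that does not end in all ones, so that
  truncating after n digits yields the left endpoint of the half-open interval of
  level n containing the point (see \<open>dyadic_interval_of_eq\<close> below).\<close>

definition dyadic_digit :: "nat \<Rightarrow> real \<Rightarrow> real" where
  "dyadic_digit k x = of_int (\<lfloor>2 ^ k * x\<rfloor> mod 2)"

definition dyadic_trunc :: "nat \<Rightarrow> real \<Rightarrow> real" where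
  "dyadic_trunc n x = (\<Sum>k=1..n. dyadic_digit k x / 2 ^ k)"

text \<open>A dyadic interval is indexed by its level and its left endpoint; the level is part of
  the index because intervals of different levels share left endpoints.\<close>

definition dyadic_nodes :: "(nat \<times> real) set" where
  "dyadic_nodes = {(n, real k / 2 ^ n) | n k. 1 \<le> n \<and> k < 2 ^ n}"

definition cascade_approx ::
    "real \<Rightarrow> (nat \<times> real \<Rightarrow> 'w \<Rightarrow> real) \<Rightarrow> nat \<Rightarrow> 'w \<Rightarrow> real measure" where
  "cascade_approx \<gamma> X n \<omega> =
     density lborel (\<lambda>x. indicator {0..<1} x *
       ennreal (exp ((\<Sum>m=1..n. \<gamma> * X (m, dyadic_trunc m x) \<omega>) - \<gamma>\<^sup>2 / 2 * real n)))"

text \<open>Weak convergence of finite Borel measures on the line. The library's \<open>weak_conv_m\<close> is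
  phrased through distribution functions and is meant for probability measures, whereas the
  measures here have varying total mass.\<close>

definition weakly_converges :: "(nat \<Rightarrow> real measure) \<Rightarrow> real measure \<Rightarrow> bool" where
  "weakly_converges \<nu> \<mu> \<longleftrightarrow>
     (\<forall>f :: real \<Rightarrow> real. continuous_on UNIV f \<and> bounded (range f) \<longrightarrow>
        (\<lambda>n. \<integral>x. f x \<partial>\<nu> n) \<longlonglongrightarrow> (\<integral>x. f x \<partial>\<mu>))"

definition random_measure_on :: "'w measure \<Rightarrow> real set \<Rightarrow> ('w \<Rightarrow> real measure) \<Rightarrow> bool" where
  "random_measure_on M S \<mu> \<longleftrightarrow>
     (\<forall>\<omega>\<in>space M. sets (\<mu> \<omega>) = sets borel \<and> finite_measure (\<mu> \<omega>) \<and> emeasure (\<mu> \<omega>) (- S) = 0) \<and>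
     (\<forall>A\<in>sets borel. (\<lambda>\<omega>. emeasure (\<mu> \<omega>) A) \<in> borel_measurable M)"

definition cascade_measure ::
    "'w measure \<Rightarrow> real \<Rightarrow> (nat \<times> real \<Rightarrow> 'w \<Rightarrow> real) \<Rightarrow> ('w \<Rightarrow> real measure) \<Rightarrow> bool" where
  "cascade_measure M \<gamma> X \<mu> \<longleftrightarrow>
     random_measure_on M {0..1} \<mu> \<and>
     (AE \<omega> in M. weakly_converges (\<lambda>n. cascade_approx \<gamma> X n \<omega>) (\<mu> \<omega>))"

lemma mem_dyadic_interval_iff:
  "x \<in> dyadic_interval n k \<longleftrightarrow> \<lfloor>2 ^ n * x\<rfloor> = int k"
  by (auto simp: dyadic_interval_def floor_eq_iff field_simps)

lemma dyadic_trunc_eq: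
  assumes "x \<in> {0..<1}"
  shows "dyadic_trunc n x = of_int \<lfloor>2 ^ n * x\<rfloor> / 2 ^ n"
proof (induction n)
  case 0
  then show ?case using assms by (simp add: dyadic_trunc_def floor_eq_iff)
next
  case (Suc n)
  let ?y = "2 ^ Suc n * x"
  have "\<lfloor>2 ^ n * x\<rfloor> = \<lfloor>?y / real_of_int 2\<rfloor>" by simp
  also have "\<dots> = \<lfloor>?y\<rfloor> div 2" by (subst floor_divide_real_eq_div) auto
  finally have "\<lfloor>?y\<rfloor> = 2 * \<lfloor>2 ^ n * x\<rfloor> + \<lfloor>?y\<rfloor> mod 2" by simp
  then have "real_of_int \<lfloor>?y\<rfloor> = 2 * of_int \<lfloor>2 ^ n * x\<rfloor> + dyadic_digit (Suc n) x"
    unfolding dyadic_digit_def by (metis of_int_add of_int_mult of_int_numeral)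
  then show ?case using Suc by (simp add: dyadic_trunc_def field_simps)
qed

lemma dyadic_interval_of_eq:
  assumes "x \<in> {0..<1}"
  shows "dyadic_interval_of n x = {dyadic_trunc n x ..< dyadic_trunc n x + 1 / 2 ^ n}"
    and "dyadic_interval_of n x = dyadic_interval n (nat \<lfloor>2 ^ n * x\<rfloor>)"
    and "nat \<lfloor>2 ^ n * x\<rfloor> < 2 ^ n"
proof -
  have nn: "0 \<le> \<lfloor>2 ^ n * x\<rfloor>" using assms by simp
  have "2 ^ n * x < 2 ^ n" using assms by simp
  then have "\<lfloor>2 ^ n * x\<rfloor> < 2 ^ n" by (simp add: floor_less_iff)
  then show lt: "nat \<lfloor>2 ^ n * x\<rfloor> < 2 ^ n" using nn by (simp add: nat_less_iff)
  show eq: "dyadic_interval_of n x = dyadic_interval n (nat \<lfloor>2 ^ n * x\<rfloor>)"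
    unfolding dyadic_interval_of_def
  proof (rule the_equality)
    show "x \<in> dyadic_interval n (nat \<lfloor>2 ^ n * x\<rfloor>) \<and>
        (\<exists>k<2 ^ n. dyadic_interval n (nat \<lfloor>2 ^ n * x\<rfloor>) = dyadic_interval n k)"
      using nn lt unfolding mem_dyadic_interval_iff by (metis nat_0_le)
  qed (auto simp: mem_dyadic_interval_iff)
  show "dyadic_interval_of n x = {dyadic_trunc n x ..< dyadic_trunc n x + 1 / 2 ^ n}"
    unfolding eq dyadic_trunc_eq[OF assms] dyadic_interval_def
    using nn by (simp add: add_divide_distrib)
qed

lemma dyadic_digits_sums:
  assumes "x \<in> {0..<1}"
  shows "(\<lambda>n. dyadic_trunc n x) \<longlonglongrightarrow> x"
proof (rule tendsto_sandwich)
  have "x - 1 / 2 ^ n \<le> dyadic_trunc n x" for n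
  proof -
    have "x - 1 / 2 ^ n = (2 ^ n * x - 1) / 2 ^ n" by (simp add: diff_divide_distrib)
    also have "\<dots> \<le> of_int \<lfloor>2 ^ n * x\<rfloor> / 2 ^ n"
      by (intro divide_right_mono) (linarith, simp)
    finally show ?thesis unfolding dyadic_trunc_eq[OF assms] .
  qed
  then show "\<forall>\<^sub>F n in sequentially. x - (1 / 2) ^ n \<le> dyadic_trunc n x"
    by (simp add: power_divide)
  have "dyadic_trunc n x \<le> x" for n
    unfolding dyadic_trunc_eq[OF assms] by (simp add: field_simps)
  then show "\<forall>\<^sub>F n in sequentially. dyadic_trunc n x \<le> x" by simp
  have "(\<lambda>n. x - (1 / 2) ^ n) \<longlonglongrightarrow> x - 0"
    by (intro tendsto_intros LIMSEQ_power_zero) simp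
  then show "(\<lambda>n. x - (1 / 2) ^ n) \<longlonglongrightarrow> x" by simp
qed simp

lemma dyadic_trunc_mem_nodes:
  assumes "x \<in> {0..<1}" "1 \<le> n"
  shows "(n, dyadic_trunc n x) \<in> dyadic_nodes"
proof -
  have "dyadic_trunc n x = real (nat \<lfloor>2 ^ n * x\<rfloor>) / 2 ^ n"
    using assms by (simp add: dyadic_trunc_eq)
  then show ?thesis
    using dyadic_interval_of_eq(3)[OF assms(1), of n] assms(2) unfolding dyadic_nodes_def by blast
qed

lemma finite_image_dyadic_intervals:
  "finite ((\<lambda>y. F (dyadic_interval_of n y) (dyadic_interval_of (Suc n) y)) ` {0..<1})"
proof (rule finite_subset)
  show "(\<lambda>y. F (dyadic_interval_of n y) (dyadic_interval_of (Suc n) y)) ` {0..<1} \<subseteq>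
    (\<lambda>(j, k). F (dyadic_interval n j) (dyadic_interval (Suc n) k)) ` ({..<2 ^ n} \<times> {..<2 ^ Suc n})"
    using dyadic_interval_of_eq(2,3) by (fastforce simp del: power_Suc)
qed simp

end

theory Submission imports Defs "HOL-Library.Discrete_Functions"
begin

text \<open>
  Write \<open>A = exp (\<gamma> g - \<gamma>\<^sup>2 / 2) / 2\<close> with a standard Gaussian \<open>g\<close>. The mass of a dyadic interval factorises
  along the binary tree: if \<open>v\<close> is a vertex of level \<open>n\<close> with children \<open>v0\<close> and \<open>v1\<close>, then
  \<open>\<mu>(I v0) = W v * V v0\<close> and \<open>\<mu>(I v1) = W v * V v1\<close>, where \<open>W v\<close> is a product of \<open>n\<close> independent copies of
  \<open>A\<close> and the \<open>V\<close> belong to disjoint subtrees and are independent of \<open>W v\<close>. The quotient at the child \<open>v1\<close> is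
  therefore at least \<open>(W v) powr \<eta> * V v0 / V v1 powr (1 - \<eta>)\<close>.

  For a typical vertex \<open>W v\<close> is about \<open>exp (- n (ln 2 + \<gamma>\<^sup>2 / 2))\<close> by the law of large numbers
  (\<open>path_weight_lower\<close>), and \<open>V v1\<close> is of order one with probability bounded below (\<open>branch_mass_bulk\<close>).
  The quotient becomes large because \<open>V v0\<close> has a heavy tail: \<open>P(V > t) \<ge> c * t powr - p\<close> for each
  \<open>p > 2 ln 2 / \<gamma>\<^sup>2\<close> (\<open>branch_mass_tail\<close>). Hence among the \<open>2 ^ n\<close> independent subtrees of level \<open>n\<close> some have
  \<open>V v0 > exp (c n)\<close> for any given \<open>c < \<gamma>\<^sup>2 / 2\<close>, and \<open>exp (c n)\<close> beats
  \<open>(W v) powr \<eta>\<close> as soon as \<open>\<eta> (ln 2 + \<gamma>\<^sup>2 / 2) < c\<close>. Such a \<open>c\<close> exists exactly when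
  \<open>\<eta> < \<gamma>\<^sup>2 / (\<gamma>\<^sup>2 + 2 ln 2)\<close>. The first vertex of level \<open>n\<close> whose subtree is good depends only on levels
  greater than \<open>n\<close>, so its weight \<open>W v\<close> still behaves like that of a typical vertex (\<open>first_success_bound\<close>).

  The tail bound is a comparison argument. The tail function \<open>H(t) = P(V > t)\<close> satisfies
  \<open>H(t) \<ge> E (2 H(t / A) - H(t / A)\<^sup>2)\<close>, since one of the two children suffices. As \<open>2 * E (A powr p) > 1\<close> for
  \<open>p > 2 ln 2 / \<gamma>\<^sup>2\<close>, a truncated multiple of \<open>t powr - p - e / t\<close> is a strict subsolution of this
  inequality (\<open>tail_profile_subsolution\<close>). It vanishes for large \<open>t\<close>, so a small multiple of it lies below
  \<open>H\<close>; strictness lets the multiple grow by a constant factor per level until it reaches its full size, and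
  \<open>e\<close> is arbitrary. That \<open>H\<close> is bounded below for \<open>t \<le> 1\<close> is the nondegeneracy of the cascade, which follows from
  \<open>\<gamma>\<^sup>2 < 2 ln 2\<close> by a moment of order \<open>q > 1\<close>.

  All probabilistic estimates concern finite truncations of the tree, with bounds that do not depend on the
  depth once it is large enough. They carry over to \<open>\<mu>\<close> because almost surely \<open>\<mu>\<close> has no atom at a dyadic point, so that the masses of dyadic
  intervals converge (\<open>cascade_cells_limit\<close>).
\<close>

section \<open>Moments of the lognormal weight\<close>

text \<open>The factor by which a vertex multiplies the mass of its interval, including the halving of the
  length; the latter is the summand \<open>ln 2\<close>.\<close>

definition weight :: "real \<Rightarrow> real \<Rightarrow> real" where
  "weight \<gamma> x = exp (\<gamma> * x - (\<gamma>\<^sup>2 / 2 + ln 2))"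

abbreviation std_normal :: "real measure" where
  "std_normal \<equiv> density lborel std_normal_density"

lemma weight_pos [simp]: "0 < weight \<gamma> x"
  by (simp add: weight_def)

lemma weight_measurable [measurable]: "weight \<gamma> \<in> borel_measurable borel"
  by (simp add: weight_def[abs_def])

lemma std_normal_mgf:
  "integrable std_normal (\<lambda>x. exp (t * x))" "(\<integral>x. exp (t * x) \<partial>std_normal) = exp (t\<^sup>2 / 2)"
proof -
  have shift: "std_normal_density x * exp (t * x) = exp (t\<^sup>2 / 2) * normal_density t 1 x" for x
    by (simp add: normal_density_def exp_add[symmetric] power2_eq_square field_simps)
  show "integrable std_normal (\<lambda>x. exp (t * x))"
    by (subst integrable_density) (auto simp: shift)
  show "(\<integral>x. exp (t * x) \<partial>std_normal) = exp (t\<^sup>2 / 2)"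
    by (subst integral_density) (auto simp: shift)
qed

definition weight_moment :: "real \<Rightarrow> real \<Rightarrow> real" where
  "weight_moment \<gamma> s = exp (s * (s * \<gamma>\<^sup>2 / 2 - (\<gamma>\<^sup>2 / 2 + ln 2)))"

lemma weight_powr: "weight \<gamma> x powr s = exp (- s * (\<gamma>\<^sup>2 / 2 + ln 2)) * exp ((s * \<gamma>) * x)"
  by (simp add: weight_def powr_def exp_add[symmetric] algebra_simps)

lemma weight_powr_integral:
  "integrable std_normal (\<lambda>x. weight \<gamma> x powr s)"
  "(\<integral>x. weight \<gamma> x powr s \<partial>std_normal) = weight_moment \<gamma> s"
proof -
  note mgf = std_normal_mgf[of "s * \<gamma>"]
  show "integrable std_normal (\<lambda>x. weight \<gamma> x powr s)"
    unfolding weight_powr by (intro integrable_mult_right mgf)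
  have "(\<integral>x. weight \<gamma> x powr s \<partial>std_normal) = exp (- s * (\<gamma>\<^sup>2 / 2 + ln 2)) * exp ((s * \<gamma>)\<^sup>2 / 2)"
    unfolding weight_powr by (subst integral_mult_right_zero) (simp only: mgf)
  also have "\<dots> = weight_moment \<gamma> s"
    by (simp add: weight_moment_def exp_add[symmetric] power2_eq_square algebra_simps)
  finally show "(\<integral>x. weight \<gamma> x powr s \<partial>std_normal) = weight_moment \<gamma> s" .
qed

lemma weight_moment_1: "weight_moment \<gamma> 1 = 1 / 2"
  by (simp add: weight_moment_def exp_minus)

lemma weight_integral: "integrable std_normal (weight \<gamma>)" "(\<integral>x. weight \<gamma> x \<partial>std_normal) = 1 / 2"
  using weight_powr_integral[of \<gamma> 1] weight_pos[of \<gamma>]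
  by (simp_all add: weight_moment_1 powr_one abs_of_pos del: powr_one_gt_zero_iff)

text \<open>Twice the moment is the mean of \<open>\<Sum> A powr s\<close> over the two children. Its logarithm is a convex
  quadratic with roots \<open>s = 1\<close> and \<open>s = 2 ln 2 / \<gamma>\<^sup>2\<close>. For \<open>\<gamma>\<^sup>2 < 2 ln 2\<close> the second root is the larger one: moments of orders between
  the roots stay bounded, those beyond blow up, and the second root is the tail exponent.\<close>

lemma two_weight_moment:
  "2 * weight_moment \<gamma> s = exp ((s - 1) * (\<gamma>\<^sup>2 * s / 2 - ln 2))"
proof -
  have "2 * weight_moment \<gamma> s = exp (ln 2) * weight_moment \<gamma> s" by simp
  also have "\<dots> = exp ((s - 1) * (\<gamma>\<^sup>2 * s / 2 - ln 2))"
    unfolding weight_moment_def exp_add[symmetric] by (simp add: field_simps)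
  finally show ?thesis .
qed

lemma prob_space_std_normal: "prob_space std_normal"
  by (rule prob_space_normal_density) simp

section \<open>A strict subsolution of the tail inequality\<close>

text \<open>The power law \<open>t powr - p\<close>, normalised and truncated at \<open>1\<close>. Subtracting \<open>e / t\<close> cuts it off at large \<open>t\<close>;
  the exponent \<open>1\<close> is convenient since \<open>2 * E A = 1\<close>.\<close>

definition tail_profile :: "real \<Rightarrow> real \<Rightarrow> real \<Rightarrow> real \<Rightarrow> real" where
  "tail_profile p B e t = max 0 (min 1 ((t powr - p - e / t) / B))"

lemma tail_profile_bounds: "0 \<le> tail_profile p B e t" "tail_profile p B e t \<le> 1"
  by (auto simp: tail_profile_def)

lemma tail_profile_measurable [measurable]: "tail_profile p B e \<in> borel_measurable borel"
  unfolding tail_profile_def[abs_def] by measurable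

text \<open>The truncation of the profile costs part of the moment; as the truncation level \<open>B\<close> grows,
  the full moment is recovered, and \<open>2 * E (A powr p) > 1\<close> is a strict inequality.\<close>

lemma truncated_moment:
  assumes "p > 1" "\<gamma>\<^sup>2 * p / 2 > ln 2"
  obtains B where "B \<ge> 1" "(\<integral>x. min B (weight \<gamma> x powr p) \<partial>std_normal) > 1 / 2"
proof -
  have "(\<lambda>n. \<integral>x. min (real n) (weight \<gamma> x powr p) \<partial>std_normal) \<longlonglongrightarrow> (\<integral>x. weight \<gamma> x powr p \<partial>std_normal)"
  proof (rule integral_dominated_convergence)
    show "integrable std_normal (\<lambda>x. weight \<gamma> x powr p)" by (rule weight_powr_integral)
    show "AE x in std_normal. (\<lambda>n. min (real n) (weight \<gamma> x powr p)) \<longlonglongrightarrow> weight \<gamma> x powr p"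
    proof (intro AE_I2 tendsto_eventually)
      fix x show "\<forall>\<^sub>F n in sequentially. min (real n) (weight \<gamma> x powr p) = weight \<gamma> x powr p"
        using eventually_ge_at_top[of "nat \<lceil>weight \<gamma> x powr p\<rceil>"]
        by eventually_elim (auto simp: min_def)
    qed
  qed auto
  moreover have "1 / 2 < (\<integral>x. weight \<gamma> x powr p \<partial>std_normal)"
  proof -
    have "1 < 2 * weight_moment \<gamma> p" unfolding two_weight_moment using assms by simp
    then show ?thesis by (simp add: weight_powr_integral)
  qed
  ultimately have "\<forall>\<^sub>F n in sequentially. 1 / 2 < (\<integral>x. min (real n) (weight \<gamma> x powr p) \<partial>std_normal)"
    by (rule order_tendstoD)
  then have "\<forall>\<^sub>F n in sequentially. 1 / 2 < (\<integral>x. min (real n) (weight \<gamma> x powr p) \<partial>std_normal) \<and> n \<ge> 1"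
    using eventually_ge_at_top[of 1] by eventually_elim auto
  then obtain n where "1 / 2 < (\<integral>x. min (real n) (weight \<gamma> x powr p) \<partial>std_normal)" "n \<ge> (1::nat)"
    by (auto simp: eventually_sequentially)
  then show thesis by (intro that[of "real n"]) auto
qed

text \<open>The factor \<open>2 - \<delta>\<close> instead of \<open>2\<close> pays for the quadratic term of the tail inequality, because
  \<open>2 h - h\<^sup>2 \<ge> (2 - \<delta>) h\<close> for \<open>0 \<le> h \<le> \<delta>\<close>. The restriction to \<open>t \<ge> 1\<close> is what makes the truncation
  harmless: the power law is truncated at height \<open>B\<close>, which is at least \<open>B\<close> times its value at \<open>t\<close>.\<close>

lemma tail_profile_subsolution:
  assumes "p > 1" "\<gamma>\<^sup>2 * p / 2 > ln 2"
  obtains \<delta> B \<rho> where "0 < \<delta>" "\<delta> \<le> 1" "B \<ge> 1" "\<rho> > 0"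
    "\<forall>e\<ge>0. \<forall>t\<ge>1. (1 + \<rho>) * tail_profile p B e t \<le> (2 - \<delta>) * (\<integral>x. tail_profile p B e (t / weight \<gamma> x) \<partial>std_normal)"
proof -
  interpret N: prob_space std_normal by (rule prob_space_std_normal)
  obtain B where B: "B \<ge> 1" "(\<integral>x. min B (weight \<gamma> x powr p) \<partial>std_normal) > 1 / 2"
    using truncated_moment[OF assms] .
  define m where "m = (\<integral>x. min B (weight \<gamma> x powr p) \<partial>std_normal)"
  have m: "m > 1 / 2" using B m_def by simp
  \<comment> \<open>The surplus \<open>2 * m - 1\<close> is shared equally between \<open>\<delta>\<close> and \<open>\<rho>\<close>.\<close>
  define \<delta> where "\<delta> = (2 * m - 1) / (2 * m)"
  have \<delta>: "0 < \<delta>" "\<delta> \<le> 1" "(2 - \<delta>) * m = 1 + (m - 1 / 2)"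
    using m by (auto simp: \<delta>_def field_simps)
  have int_min: "integrable std_normal (\<lambda>x. min B (weight \<gamma> x powr p))"
    by (rule N.integrable_const_bound[where B = B]) (use B in \<open>auto simp: min_def\<close>)
  have "(1 + (m - 1 / 2)) * tail_profile p B e t
      \<le> (2 - \<delta>) * (\<integral>x. tail_profile p B e (t / weight \<gamma> x) \<partial>std_normal)"
    if e: "e \<ge> 0" and t: "t \<ge> 1" for e t :: real
  proof -
    define \<tau> where "\<tau> = t powr - p"
    have \<tau>: "0 < \<tau>" "\<tau> \<le> 1"
      using t assms by (auto simp: \<tau>_def powr_minus intro!: inverse_le_1_iff[THEN iffD2] ge_one_powr_ge_zero)
    have pw: "\<tau> / B * min B (weight \<gamma> x powr p) - e / (t * B) * weight \<gamma> x
        \<le> tail_profile p B e (t / weight \<gamma> x)" for x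
    proof -
      let ?w = "weight \<gamma> x"
      have eq: "(t / ?w) powr - p = \<tau> * ?w powr p"
      proof -
        have "(t / ?w) powr - p = inverse (t powr p / ?w powr p)"
          using t weight_pos[of \<gamma> x] by (simp only: powr_minus powr_divide less_imp_le)
        then show ?thesis by (simp add: \<tau>_def powr_minus field_simps)
      qed
      have "\<tau> / B * min B (?w powr p) \<le> min 1 (\<tau> * ?w powr p / B)"
      proof (rule min.boundedI)
        have "\<tau> / B * min B (?w powr p) \<le> \<tau> / B * B" using \<tau> B by (intro mult_left_mono) auto
        also have "\<dots> \<le> 1" using \<tau> B by simp
        finally show "\<tau> / B * min B (?w powr p) \<le> 1" .
        have "\<tau> / B * min B (?w powr p) \<le> \<tau> / B * ?w powr p" using \<tau> B by (intro mult_left_mono) auto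
        then show "\<tau> / B * min B (?w powr p) \<le> \<tau> * ?w powr p / B" by simp
      qed
      moreover have "e / (t * B) * ?w \<ge> 0" using e t B by (intro mult_nonneg_nonneg divide_nonneg_nonneg) (auto intro: weight_pos[THEN less_imp_le])
      moreover have "((t / ?w) powr - p - e / (t / ?w)) / B = \<tau> * ?w powr p / B - e / (t * B) * ?w"
        unfolding eq by (simp add: diff_divide_distrib)
      ultimately show ?thesis unfolding tail_profile_def by linarith
    qed
    have "\<tau> / B * m - e / (t * B) * (1 / 2)
        = (\<integral>x. \<tau> / B * min B (weight \<gamma> x powr p) - e / (t * B) * weight \<gamma> x \<partial>std_normal)"
      by (subst Bochner_Integration.integral_diff)
        (simp_all add: m_def int_min weight_integral)
    also have "\<dots> \<le> (\<integral>x. tail_profile p B e (t / weight \<gamma> x) \<partial>std_normal)"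
    proof (rule integral_mono[OF _ _ pw])
      show "integrable std_normal (\<lambda>x. tail_profile p B e (t / weight \<gamma> x))"
        by (rule N.integrable_const_bound[where B = 1]) (auto simp: tail_profile_bounds)
    qed (simp add: int_min weight_integral)
    finally have lower: "\<tau> / B * m - e / (t * B) * (1 / 2) \<le> (\<integral>x. tail_profile p B e (t / weight \<gamma> x) \<partial>std_normal)" .
    have nonneg: "0 \<le> (2 - \<delta>) * (\<integral>x. tail_profile p B e (t / weight \<gamma> x) \<partial>std_normal)"
      using \<delta> by (intro mult_nonneg_nonneg Bochner_Integration.integral_nonneg) (simp_all add: tail_profile_bounds)
    have "(1 + (m - 1 / 2)) * ((\<tau> - e / t) / B) \<le> (2 - \<delta>) * (\<tau> / B * m - e / (t * B) * (1 / 2))"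
    proof -
      have "(2 - \<delta>) / 2 * (e / (t * B)) \<le> (1 + (m - 1 / 2)) * (e / (t * B))"
        using \<delta> m e t B by (intro mult_right_mono) auto
      then have "(1 + (m - 1 / 2)) * (\<tau> / B) - (1 + (m - 1 / 2)) * (e / (t * B))
          \<le> ((2 - \<delta>) * m) * (\<tau> / B) - (2 - \<delta>) / 2 * (e / (t * B))"
        unfolding \<delta>(3) by linarith
      then show ?thesis by (simp add: algebra_simps diff_divide_distrib)
    qed
    also have "\<dots> \<le> (2 - \<delta>) * (\<integral>x. tail_profile p B e (t / weight \<gamma> x) \<partial>std_normal)"
      using lower \<delta> by (intro mult_left_mono) auto
    finally have main: "(1 + (m - 1 / 2)) * ((\<tau> - e / t) / B)
      \<le> (2 - \<delta>) * (\<integral>x. tail_profile p B e (t / weight \<gamma> x) \<partial>std_normal)" .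
    have "(1 + (m - 1 / 2)) * tail_profile p B e t \<le> (1 + (m - 1 / 2)) * max 0 ((\<tau> - e / t) / B)"
      unfolding tail_profile_def \<tau>_def[symmetric] using m by (intro mult_left_mono) auto
    also have "\<dots> = max 0 ((1 + (m - 1 / 2)) * ((\<tau> - e / t) / B))"
      using m by (subst max_mult_distrib_left) auto
    finally have "(1 + (m - 1 / 2)) * tail_profile p B e t \<le> max 0 ((1 + (m - 1 / 2)) * ((\<tau> - e / t) / B))" .
    with main nonneg show ?thesis by linarith
  qed
  then show thesis using that[of \<delta> B "m - 1/2"] \<delta> B m by auto
qed

section \<open>The binary tree in heap order\<close>

text \<open>Vertices are the positive integers: \<open>1\<close> is the root, the children of \<open>i\<close> are \<open>2 * i\<close> and \<open>2 * i + 1\<close>, and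
  level \<open>n\<close> is \<open>{2 ^ n..<2 ^ Suc n}\<close>. Moving to the parent is \<open>div 2\<close>, which turns disjointness of subtrees into
  arithmetic.\<close>

definition subtree :: "nat \<Rightarrow> nat set" where
  "subtree i = {m. \<exists>d. m div 2 ^ d = i}"

lemma subtree_self [simp]: "i \<in> subtree i"
  unfolding subtree_def by (auto intro: exI[of _ 0])

lemma subtree_child: "subtree (2 * i) \<subseteq> subtree i" "subtree (Suc (2 * i)) \<subseteq> subtree i"
proof -
  have sub: "subtree k \<subseteq> subtree i" if "k div 2 = i" for k
  proof
    fix m assume "m \<in> subtree k"
    then obtain d where "m div 2 ^ d = k" unfolding subtree_def by blast
    with that have "m div 2 ^ Suc d = i" by (simp only: power_Suc2 div_mult2_eq)
    then show "m \<in> subtree i" unfolding subtree_def by blast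
  qed
  show "subtree (2 * i) \<subseteq> subtree i" by (rule sub) simp
  show "subtree (Suc (2 * i)) \<subseteq> subtree i" by (rule sub) simp
qed

lemma subtree_ge: "subtree i \<subseteq> {i..}"
  unfolding subtree_def by auto

lemma floor_log_div_power: "floor_log (n div 2 ^ d) = floor_log n - d"
proof (induction d)
  case (Suc d)
  have "n div 2 ^ Suc d = n div 2 ^ d div 2"
    by (simp only: power_Suc2 div_mult2_eq)
  then show ?case using Suc by simp
qed simp

lemma subtree_disjoint:
  assumes "i > 0" "i' > 0" "floor_log i = floor_log i'" "i \<noteq> i'"
  shows "subtree i \<inter> subtree i' = {}"
proof -
  have False if "m div 2 ^ d = i" "m div 2 ^ d' = i'" "d \<le> d'"
    "i > 0" "i' > 0" "floor_log i = floor_log i'" "i \<noteq> i'" for m d d' i i' :: nat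
  proof -
    have "i' = i div 2 ^ (d' - d)"
      using that(1-3) by (metis div_mult2_eq le_add_diff_inverse power_add)
    moreover from this have "floor_log i = floor_log i - (d' - d)"
      using floor_log_div_power[of i "d' - d"] that by simp
    then have "floor_log i = 0 \<or> d' - d = 0" by linarith
    moreover have "i = 1 \<and> i' = 1" if "floor_log i = 0"
      using floor_log_exp2_gt[of i] floor_log_exp2_gt[of i'] that \<open>i > 0\<close> \<open>i' > 0\<close>
        \<open>floor_log i = floor_log i'\<close> by simp
    ultimately show False using \<open>i \<noteq> i'\<close> by auto
  qed
  then show ?thesis
    using assms unfolding subtree_def by (auto; metis nat_le_linear)
qed

lemma subtree_children_disjoint:
  assumes "i > 0" shows "subtree (2 * i) \<inter> subtree (Suc (2 * i)) = {}"
  using assms by (intro subtree_disjoint) (auto simp: floor_log_rec)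

lemma subtree_children_proper:
  assumes "i > 0" shows "subtree (2 * i) \<union> subtree (Suc (2 * i)) \<subseteq> {i<..}"
  using assms subtree_ge[of "2 * i"] subtree_ge[of "Suc (2 * i)"] by fastforce

text \<open>The mass that the cascade truncated \<open>j\<close> levels below vertex \<open>i\<close> gives to the interval of \<open>i\<close>, divided by
  the weight of the path down to the parent of \<open>i\<close>. The weight of \<open>i\<close> itself is included, which leaves
  the values at two siblings independent.\<close>

primrec branch_mass :: "real \<Rightarrow> nat \<Rightarrow> nat \<Rightarrow> (nat \<Rightarrow> real) \<Rightarrow> real" where
  "branch_mass \<gamma> 0 i x = weight \<gamma> (x i)"
| "branch_mass \<gamma> (Suc j) i x =
    weight \<gamma> (x i) * (branch_mass \<gamma> j (2 * i) x + branch_mass \<gamma> j (Suc (2 * i)) x)"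

text \<open>The product of the weights from level 1 down to \<open>i\<close>; the root carries no random variable.\<close>

fun path_weight :: "real \<Rightarrow> nat \<Rightarrow> (nat \<Rightarrow> real) \<Rightarrow> real" where
  "path_weight \<gamma> i x = (if i < 2 then 1 else path_weight \<gamma> (i div 2) x * weight \<gamma> (x i))"

declare path_weight.simps [simp del]

lemma path_weight_simps:
  "i < 2 \<Longrightarrow> path_weight \<gamma> i x = 1"
  "i \<ge> 2 \<Longrightarrow> path_weight \<gamma> i x = path_weight \<gamma> (i div 2) x * weight \<gamma> (x i)"
  by (subst path_weight.simps, simp)+

lemma branch_mass_pos [simp]: "0 < branch_mass \<gamma> j i x"
  by (induction j arbitrary: i) (simp_all add: add_pos_pos)

lemma path_weight_pos [simp]: "0 < path_weight \<gamma> i x"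
  by (induction i rule: less_induct) (subst path_weight.simps, simp)

text \<open>A measurable function of the coordinates in \<open>A\<close> that is defined on all arrays. Independence of functionals
  on the tree then reduces to disjointness of index sets.\<close>

definition depends_on :: "nat set \<Rightarrow> ((nat \<Rightarrow> real) \<Rightarrow> real) \<Rightarrow> bool" where
  "depends_on A f \<longleftrightarrow> f \<in> borel_measurable (PiM A (\<lambda>_. borel)) \<and> (\<forall>x. f (restrict x A) = f x)"

lemma depends_on_mono:
  assumes "depends_on A f" "A \<subseteq> B" shows "depends_on B f"
  unfolding depends_on_def
proof
  have "(\<lambda>x. f (restrict x A)) \<in> borel_measurable (PiM B (\<lambda>_. borel))"
    using assms unfolding depends_on_def
    by (intro measurable_compose[OF measurable_restrict_subset]) auto
  then show "f \<in> borel_measurable (PiM B (\<lambda>_. borel))"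
    using assms by (simp add: depends_on_def)
  have "restrict (restrict x B) A = restrict x A" for x :: "nat \<Rightarrow> real"
    using assms(2) by (simp add: Int_absorb1)
  then show "\<forall>x. f (restrict x B) = f x"
    using assms(1) unfolding depends_on_def by metis
qed

lemma depends_on_coord: "i \<in> A \<Longrightarrow> depends_on A (\<lambda>x. x i)"
  by (simp add: depends_on_def measurable_component_singleton)

lemma depends_on_compose:
  assumes "depends_on A f" "h \<in> borel_measurable borel"
  shows "depends_on A (\<lambda>x. h (f x))"
  using assms by (auto simp: depends_on_def intro: measurable_compose)

lemma depends_on_const [simp]: "depends_on A (\<lambda>x. c)"
  by (simp add: depends_on_def)

lemma depends_on_add: "depends_on A f \<Longrightarrow> depends_on A g \<Longrightarrow> depends_on A (\<lambda>x. f x + g x)"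
  by (auto simp: depends_on_def)

lemma depends_on_mult: "depends_on A f \<Longrightarrow> depends_on A g \<Longrightarrow> depends_on A (\<lambda>x. f x * g x)"
  by (auto simp: depends_on_def)

lemma depends_on_prod:
  "(\<And>k. k \<in> K \<Longrightarrow> depends_on A (f k)) \<Longrightarrow> depends_on A (\<lambda>x. \<Prod>k\<in>K. f k x)"
  by (auto simp: depends_on_def intro!: borel_measurable_prod)

lemma depends_on_branch_mass: "depends_on (subtree i) (branch_mass \<gamma> j i)"
proof (induction j arbitrary: i)
  case 0
  show ?case using depends_on_compose[OF depends_on_coord[OF subtree_self] weight_measurable] by simp
next
  case (Suc j)
  have "depends_on (subtree i) (\<lambda>x. weight \<gamma> (x i) * (branch_mass \<gamma> j (2 * i) x + branch_mass \<gamma> j (Suc (2 * i)) x))"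
    by (intro depends_on_mult depends_on_add depends_on_compose[OF depends_on_coord weight_measurable]
        subtree_self depends_on_mono[OF Suc] subtree_child)
  then show ?case by simp
qed

lemma depends_on_path_weight: "depends_on {2..i} (path_weight \<gamma> i)"
proof (induction i rule: less_induct)
  case (less i)
  show ?case
  proof (cases "i < 2")
    case True
    then have "path_weight \<gamma> i = (\<lambda>x. 1)" by (simp add: path_weight_simps fun_eq_iff)
    then show ?thesis by simp
  next
    case False
    then have "path_weight \<gamma> i = (\<lambda>x. path_weight \<gamma> (i div 2) x * weight \<gamma> (x i))"
      by (simp add: path_weight_simps fun_eq_iff)
    moreover have "depends_on {2..i} (\<lambda>x. path_weight \<gamma> (i div 2) x * weight \<gamma> (x i))"
      using False by (intro depends_on_mult depends_on_compose[OF depends_on_coord weight_measurable]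
        depends_on_mono[OF less]) auto
    ultimately show ?thesis by simp
  qed
qed

section \<open>Subadditivity of powers\<close>

lemma powr_add_le:
  fixes u v r :: real
  assumes "0 < u" "0 < v" "0 < r" "r \<le> 1"
  shows "(u + v) powr r \<le> u powr r + v powr r"
proof -
  have frac: "z / (u + v) \<le> (z / (u + v)) powr r" if "0 < z" "z < u + v" for z
  proof -
    have "(z / (u + v)) powr 1 \<le> (z / (u + v)) powr r"
      using that assms by (intro powr_mono') auto
    then show ?thesis using that by simp
  qed
  have "1 = u / (u + v) + v / (u + v)"
    using assms by (simp add: add_divide_distrib[symmetric])
  also have "\<dots> \<le> (u / (u + v)) powr r + (v / (u + v)) powr r"
    using assms by (intro add_mono frac) auto
  also have "\<dots> = (u powr r + v powr r) / (u + v) powr r"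
    using assms by (simp add: powr_divide add_divide_distrib)
  finally show ?thesis using assms by (simp add: field_simps)
qed

text \<open>The square of the subadditivity inequality for the exponent \<open>q / 2 \<le> 1\<close>. Mixed terms get exponent
  \<open>q / 2\<close>, so that their expectation is controlled by the mean alone.\<close>

lemma powr_add_le_half:
  fixes u v q :: real
  assumes "0 < u" "0 < v" "0 < q" "q \<le> 2"
  shows "(u + v) powr q \<le> u powr q + v powr q + 2 * (u powr (q / 2) * v powr (q / 2))"
proof -
  have sq: "z powr q = (z powr (q / 2))\<^sup>2" if "z > 0" for z :: real
    using that by (simp add: power2_eq_square powr_add[symmetric])
  have "(u + v) powr q \<le> (u powr (q / 2) + v powr (q / 2))\<^sup>2"
    unfolding sq[OF add_pos_pos[OF assms(1,2)]]
    using assms powr_add_le[of u v "q / 2"] by (intro power_mono) auto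
  then show ?thesis using assms by (simp add: sq power2_sum)
qed

section \<open>Gaussian trees: independence and moments\<close>

locale iid_normal_tree = prob_space M for M :: "'w measure" +
  fixes \<gamma> :: real and \<xi> :: "nat \<Rightarrow> 'w \<Rightarrow> real"
  assumes indep: "indep_vars (\<lambda>_. borel) \<xi> {2..}"
    and normal: "\<And>i. i \<ge> 2 \<Longrightarrow> distributed M lborel (\<xi> i) std_normal_density"
begin

definition env :: "'w \<Rightarrow> nat \<Rightarrow> real" where
  "env \<omega> = (\<lambda>i. \<xi> i \<omega>)"

lemma distr_xi: "i \<ge> 2 \<Longrightarrow> distr M borel (\<xi> i) = std_normal"
  using distributed_distr_eq_density[OF normal[of i]] by (simp cong: distr_cong)

lemma xi_measurable: "i \<ge> 2 \<Longrightarrow> \<xi> i \<in> borel_measurable M"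
  using distributed_measurable[OF normal[of i]] by simp

lemma expectation_xi:
  fixes h :: "real \<Rightarrow> real"
  assumes "i \<ge> 2" "integrable std_normal h" "h \<in> borel_measurable borel"
  shows "integrable M (\<lambda>\<omega>. h (env \<omega> i))" "expectation (\<lambda>\<omega>. h (env \<omega> i)) = (\<integral>x. h x \<partial>std_normal)"
  using assms xi_measurable[of i] unfolding distr_xi[OF assms(1), symmetric] env_def
  by (simp_all add: integrable_distr_eq integral_distr)

lemma indep_vars_blocks:
  assumes "disjoint_family_on A L" "\<And>l. l \<in> L \<Longrightarrow> A l \<subseteq> {2..}" "\<And>l. l \<in> L \<Longrightarrow> depends_on (A l) (f l)"
  shows "indep_vars (\<lambda>_. borel) (\<lambda>l \<omega>. f l (env \<omega>)) L"
proof -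
  have "indep_vars (\<lambda>_. borel) (\<lambda>l \<omega>. f l (restrict (\<lambda>i. \<xi> i \<omega>) (A l))) L"
    by (rule indep_vars_compose2[OF indep_vars_restrict[OF indep]])
      (use assms in \<open>auto simp: depends_on_def\<close>)
  then show ?thesis
    by (subst indep_vars_cong) (use assms in \<open>auto simp: depends_on_def env_def\<close>)
qed

lemma indep_var_blocks:
  assumes "A \<inter> B = {}" "A \<subseteq> {2..}" "B \<subseteq> {2..}" "depends_on A f" "depends_on B g"
  shows "indep_var borel (\<lambda>\<omega>. f (env \<omega>)) borel (\<lambda>\<omega>. g (env \<omega>))"
proof -
  have "indep_var borel (f \<circ> (\<lambda>\<omega>. restrict (\<lambda>i. \<xi> i \<omega>) A)) borel (g \<circ> (\<lambda>\<omega>. restrict (\<lambda>i. \<xi> i \<omega>) B))"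
    by (rule indep_var_compose[OF indep_var_restrict[OF indep assms(1-3)]])
      (use assms in \<open>auto simp: depends_on_def\<close>)
  moreover have "f \<circ> (\<lambda>\<omega>. restrict (\<lambda>i. \<xi> i \<omega>) A) = (\<lambda>\<omega>. f (env \<omega>))"
    "g \<circ> (\<lambda>\<omega>. restrict (\<lambda>i. \<xi> i \<omega>) B) = (\<lambda>\<omega>. g (env \<omega>))"
    using assms by (auto simp: depends_on_def env_def fun_eq_iff)
  ultimately show ?thesis by simp
qed

lemma depends_on_measurable:
  assumes "A \<subseteq> {2..}" "depends_on A f"
  shows "(\<lambda>\<omega>. f (env \<omega>)) \<in> borel_measurable M"
  using indep_var_rv1[OF indep_var_blocks[of A "{}" f "\<lambda>_. 0"]] assms by simp

lemma branch_mass_measurable: "i \<ge> 2 \<Longrightarrow> (\<lambda>\<omega>. branch_mass \<gamma> j i (env \<omega>)) \<in> borel_measurable M"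
  using subtree_ge[of i] by (intro depends_on_measurable[OF _ depends_on_branch_mass]) auto

lemma path_weight_measurable: "(\<lambda>\<omega>. path_weight \<gamma> i (env \<omega>)) \<in> borel_measurable M"
  by (rule depends_on_measurable[OF _ depends_on_path_weight]) auto

lemma indep_siblings:
  fixes f g :: "real \<Rightarrow> real"
  assumes "i \<ge> 2" "f \<in> borel_measurable borel" "g \<in> borel_measurable borel"
  shows "indep_var borel (\<lambda>\<omega>. f (branch_mass \<gamma> j (2 * i) (env \<omega>)))
    borel (\<lambda>\<omega>. g (branch_mass \<gamma> j' (Suc (2 * i)) (env \<omega>)))"
proof (rule indep_var_blocks[OF subtree_children_disjoint[of i]])
  show "subtree (2 * i) \<subseteq> {2..}" "subtree (Suc (2 * i)) \<subseteq> {2..}"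
    using assms subtree_ge[of "2 * i"] subtree_ge[of "Suc (2 * i)"] by auto
qed (use assms in \<open>auto intro: depends_on_compose[OF depends_on_branch_mass]\<close>)

lemma indep_node_children:
  fixes f g :: "real \<Rightarrow> real"
  assumes "i \<ge> 2" "f \<in> borel_measurable borel" "g \<in> borel_measurable borel"
  shows "indep_var borel (\<lambda>\<omega>. f (env \<omega> i))
    borel (\<lambda>\<omega>. g (branch_mass \<gamma> j (2 * i) (env \<omega>) + branch_mass \<gamma> j (Suc (2 * i)) (env \<omega>)))"
proof -
  let ?B = "subtree (2 * i) \<union> subtree (Suc (2 * i))"
  have "depends_on ?B (\<lambda>x. g (branch_mass \<gamma> j (2 * i) x + branch_mass \<gamma> j (Suc (2 * i)) x))"
    using assms(3) by (intro depends_on_compose[of _ _ g] depends_on_add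
        depends_on_mono[OF depends_on_branch_mass]) auto
  then show ?thesis
    using assms subtree_children_proper[of i]
    by (intro indep_var_blocks[of "{i}" ?B] depends_on_compose[OF depends_on_coord]) auto
qed

lemma branch_mass_mean:
  assumes "i \<ge> 2"
  shows "integrable M (\<lambda>\<omega>. branch_mass \<gamma> j i (env \<omega>)) \<and> expectation (\<lambda>\<omega>. branch_mass \<gamma> j i (env \<omega>)) = 1 / 2"
  using assms
proof (induction j arbitrary: i)
  case 0
  then show ?case using expectation_xi[OF 0 weight_integral(1)] by (simp add: weight_integral)
next
  case (Suc j)
  let ?U = "\<lambda>\<omega>. branch_mass \<gamma> j (2 * i) (env \<omega>) + branch_mass \<gamma> j (Suc (2 * i)) (env \<omega>)"
  have U: "integrable M ?U" "expectation ?U = 1"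
    using Suc.IH[of "2 * i"] Suc.IH[of "Suc (2 * i)"] Suc.prems by auto
  have w: "integrable M (\<lambda>\<omega>. weight \<gamma> (env \<omega> i))" "expectation (\<lambda>\<omega>. weight \<gamma> (env \<omega> i)) = 1 / 2"
    using expectation_xi[OF Suc.prems weight_integral(1)] by (simp_all add: weight_integral)
  have ind: "indep_var borel (\<lambda>\<omega>. weight \<gamma> (env \<omega> i)) borel ?U"
    by (rule indep_node_children[OF Suc.prems weight_measurable measurable_ident_sets[OF refl]])
  have "integrable M (\<lambda>\<omega>. weight \<gamma> (env \<omega> i) * ?U \<omega>)"
    by (rule indep_var_integrable[OF ind w(1) U(1)])
  moreover have "expectation (\<lambda>\<omega>. weight \<gamma> (env \<omega> i) * ?U \<omega>) = 1 / 2"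
    unfolding indep_var_lebesgue_integral[OF ind w(1) U(1)] w(2) U(2) by simp
  ultimately show ?case by simp
qed

text \<open>By \<open>powr_add_le_half\<close> the \<open>q\<close>-th moment \<open>m j\<close> obeys
  \<open>m (j + 1) \<le> \<kappa> / 2 * (2 * m j + 2 * (3 / 2)\<^sup>2)\<close> with \<open>\<kappa> = 2 * E (A powr q) < 1\<close>, where \<open>3 / 2\<close> bounds the
  moment of order \<open>q / 2\<close> because \<open>x powr (q / 2) \<le> 1 + x\<close>. The stated bound is preserved by this recursion.\<close>

lemma branch_mass_moment:
  assumes "1 < q" "q \<le> 2" "2 * weight_moment \<gamma> q < 1" "i \<ge> 2"
  shows "integrable M (\<lambda>\<omega>. branch_mass \<gamma> j i (env \<omega>) powr q) \<and>
    expectation (\<lambda>\<omega>. branch_mass \<gamma> j i (env \<omega>) powr q) \<le> 9 / 4 / (1 - 2 * weight_moment \<gamma> q)"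
  using assms(4)
proof (induction j arbitrary: i)
  case 0
  have "weight_moment \<gamma> q \<le> 9 / 4 / (1 - 2 * weight_moment \<gamma> q)"
  proof -
    have "weight_moment \<gamma> q > 0" by (simp add: weight_moment_def)
    then have "weight_moment \<gamma> q * (1 - 2 * weight_moment \<gamma> q) \<le> 1 * 1"
      using assms by (intro mult_mono) auto
    then show ?thesis using assms by (simp add: field_simps)
  qed
  then show ?case
    using expectation_xi[OF 0 weight_powr_integral(1)] by (simp add: weight_powr_integral)
next
  case (Suc j)
  define \<kappa> where "\<kappa> = 2 * weight_moment \<gamma> q"
  have \<kappa>: "0 < \<kappa>" "\<kappa> < 1" using assms by (auto simp: \<kappa>_def weight_moment_def)
  define V0 where "V0 = (\<lambda>\<omega>. branch_mass \<gamma> j (2 * i) (env \<omega>))"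
  define V1 where "V1 = (\<lambda>\<omega>. branch_mass \<gamma> j (Suc (2 * i)) (env \<omega>))"
  have pos: "V0 \<omega> > 0" "V1 \<omega> > 0" for \<omega> by (simp_all add: V0_def V1_def)
  have [measurable]: "V0 \<in> borel_measurable M" "V1 \<in> borel_measurable M"
    using Suc.prems by (auto simp: V0_def V1_def intro!: branch_mass_measurable)
  have IH: "integrable M (\<lambda>\<omega>. V0 \<omega> powr q)" "integrable M (\<lambda>\<omega>. V1 \<omega> powr q)"
    "expectation (\<lambda>\<omega>. V0 \<omega> powr q) \<le> 9 / 4 / (1 - \<kappa>)" "expectation (\<lambda>\<omega>. V1 \<omega> powr q) \<le> 9 / 4 / (1 - \<kappa>)"
    using Suc.IH[of "2 * i"] Suc.IH[of "Suc (2 * i)"] Suc.prems by (auto simp: V0_def V1_def \<kappa>_def)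
  have mean: "integrable M V0" "expectation V0 = 1 / 2" "integrable M V1" "expectation V1 = 1 / 2"
    using branch_mass_mean[of "2 * i" j] branch_mass_mean[of "Suc (2 * i)" j] Suc.prems
    by (auto simp: V0_def V1_def)
  have half: "integrable M (\<lambda>\<omega>. V \<omega> powr (q / 2)) \<and> expectation (\<lambda>\<omega>. V \<omega> powr (q / 2)) \<le> 3 / 2"
    if V: "integrable M V" "expectation V = 1 / 2" "\<And>\<omega>. V \<omega> > 0" for V
  proof -
    have [measurable]: "V \<in> borel_measurable M" using V(1) by simp
    have le: "V \<omega> powr (q / 2) \<le> 1 + V \<omega>" for \<omega>
    proof (cases "V \<omega> \<le> 1")
      case True
      then have "V \<omega> powr (q / 2) \<le> 1 powr (q / 2)"
        using V(3)[of \<omega>] assms by (intro powr_mono2) auto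
      then show ?thesis using V(3)[of \<omega>] by simp
    next
      case False
      then have "V \<omega> powr (q / 2) \<le> V \<omega> powr 1" using assms by (intro powr_mono) auto
      then show ?thesis using V(3)[of \<omega>] by simp
    qed
    have i1: "integrable M (\<lambda>\<omega>. 1 + V \<omega>)" using V(1) by simp
    have int: "integrable M (\<lambda>\<omega>. V \<omega> powr (q / 2))"
      by (rule Bochner_Integration.integrable_bound[OF i1]) (use le V(3) in \<open>auto intro!: AE_I2 order_trans[OF le]\<close>)
    have "expectation (\<lambda>\<omega>. V \<omega> powr (q / 2)) \<le> expectation (\<lambda>\<omega>. 1 + V \<omega>)"
      by (rule integral_mono[OF int i1 le])
    also have "\<dots> = 3 / 2" using V by (simp add: prob_space)
    finally show ?thesis using int by simp
  qed
  have ind01: "indep_var borel (\<lambda>\<omega>. V0 \<omega> powr (q / 2)) borel (\<lambda>\<omega>. V1 \<omega> powr (q / 2))"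
    unfolding V0_def V1_def using Suc.prems
    by (intro indep_siblings[of i "\<lambda>x. x powr (q / 2)" "\<lambda>x. x powr (q / 2)"]) auto
  note half0 = half[OF mean(1,2) pos(1)] and half1 = half[OF mean(3,4) pos(2)]
  note cross_int = indep_var_integrable[OF ind01 half0[THEN conjunct1] half1[THEN conjunct1]]
  have "expectation (\<lambda>\<omega>. V0 \<omega> powr (q / 2) * V1 \<omega> powr (q / 2))
      = expectation (\<lambda>\<omega>. V0 \<omega> powr (q / 2)) * expectation (\<lambda>\<omega>. V1 \<omega> powr (q / 2))"
    by (rule indep_var_lebesgue_integral[OF ind01 half0[THEN conjunct1] half1[THEN conjunct1]])
  also have "\<dots> \<le> 3 / 2 * (3 / 2)"
    using half0 half1 by (intro mult_mono) auto
  finally have cross: "expectation (\<lambda>\<omega>. V0 \<omega> powr (q / 2) * V1 \<omega> powr (q / 2)) \<le> 9 / 4" by simp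
  have le: "(V0 \<omega> + V1 \<omega>) powr q \<le> V0 \<omega> powr q + V1 \<omega> powr q + 2 * (V0 \<omega> powr (q / 2) * V1 \<omega> powr (q / 2))" for \<omega>
    using assms pos by (intro powr_add_le_half) auto
  have i2: "integrable M (\<lambda>\<omega>. V0 \<omega> powr q + V1 \<omega> powr q + 2 * (V0 \<omega> powr (q / 2) * V1 \<omega> powr (q / 2)))"
    using IH cross_int by simp
  have U_int: "integrable M (\<lambda>\<omega>. (V0 \<omega> + V1 \<omega>) powr q)"
    by (rule Bochner_Integration.integrable_bound[OF i2]) (use le in \<open>auto simp: abs_of_nonneg intro: order_trans[OF le]\<close>)
  have "expectation (\<lambda>\<omega>. (V0 \<omega> + V1 \<omega>) powr q)
      \<le> expectation (\<lambda>\<omega>. V0 \<omega> powr q + V1 \<omega> powr q + 2 * (V0 \<omega> powr (q / 2) * V1 \<omega> powr (q / 2)))"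
    by (rule integral_mono[OF U_int i2 le])
  also have "\<dots> = expectation (\<lambda>\<omega>. V0 \<omega> powr q) + expectation (\<lambda>\<omega>. V1 \<omega> powr q)
      + 2 * expectation (\<lambda>\<omega>. V0 \<omega> powr (q / 2) * V1 \<omega> powr (q / 2))"
    using IH cross_int by simp
  finally have U_le: "expectation (\<lambda>\<omega>. (V0 \<omega> + V1 \<omega>) powr q) \<le> 2 * (9 / 4 / (1 - \<kappa>)) + 2 * (9 / 4)"
    using IH cross by linarith
  have w: "integrable M (\<lambda>\<omega>. weight \<gamma> (env \<omega> i) powr q)"
    "expectation (\<lambda>\<omega>. weight \<gamma> (env \<omega> i) powr q) = \<kappa> / 2"
    using expectation_xi[OF Suc.prems weight_powr_integral(1)]
    by (simp_all add: weight_powr_integral \<kappa>_def)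
  have ind: "indep_var borel (\<lambda>\<omega>. weight \<gamma> (env \<omega> i) powr q) borel (\<lambda>\<omega>. (V0 \<omega> + V1 \<omega>) powr q)"
    unfolding V0_def V1_def
    using indep_node_children[OF Suc.prems, of "\<lambda>x. weight \<gamma> x powr q" "\<lambda>x. x powr q" j] by simp
  have eq: "branch_mass \<gamma> (Suc j) i (env \<omega>) powr q = weight \<gamma> (env \<omega> i) powr q * (V0 \<omega> + V1 \<omega>) powr q" for \<omega>
    using pos[of \<omega>] by (simp add: V0_def V1_def powr_mult)
  have "expectation (\<lambda>\<omega>. branch_mass \<gamma> (Suc j) i (env \<omega>) powr q) = \<kappa> / 2 * expectation (\<lambda>\<omega>. (V0 \<omega> + V1 \<omega>) powr q)"
    unfolding eq indep_var_lebesgue_integral[OF ind w(1) U_int] w(2) ..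
  also have "\<dots> \<le> \<kappa> / 2 * (2 * (9 / 4 / (1 - \<kappa>)) + 2 * (9 / 4))"
    using U_le \<kappa> by (intro mult_left_mono) auto
  also have "\<dots> = 9 / 4 * (\<kappa> * (2 - \<kappa>)) / (1 - \<kappa>)"
    using \<kappa> by (simp add: field_simps)
  also have "\<dots> \<le> 9 / 4 * 1 / (1 - \<kappa>)"
  proof -
    have "\<kappa> * (2 - \<kappa>) = 1 - (1 - \<kappa>)\<^sup>2" by (simp add: power2_eq_square algebra_simps)
    then have "\<kappa> * (2 - \<kappa>) \<le> 1" by simp
    then show ?thesis using \<kappa> by (intro divide_right_mono mult_left_mono) auto
  qed
  finally have "expectation (\<lambda>\<omega>. branch_mass \<gamma> (Suc j) i (env \<omega>) powr q) \<le> 9 / 4 / (1 - \<kappa>)" by simp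
  moreover have "integrable M (\<lambda>\<omega>. branch_mass \<gamma> (Suc j) i (env \<omega>) powr q)"
    unfolding eq by (rule indep_var_integrable[OF ind w(1) U_int])
  ultimately show ?case by (simp add: \<kappa>_def)
qed

section \<open>Mass of a subtree and weight of a path\<close>

text \<open>Any order strictly between the two roots in \<open>two_weight_moment\<close> will do; the bound \<open>q \<le> 2\<close> is the one
  required by \<open>powr_add_le_half\<close>.\<close>

lemma subcritical_exponent:
  assumes "\<gamma> > 0" "\<gamma>\<^sup>2 < 2 * ln 2"
  obtains q where "1 < q" "q \<le> 2" "2 * weight_moment \<gamma> q < 1"
proof -
  have "1 < min 2 (2 * ln 2 / \<gamma>\<^sup>2)" using assms by (simp add: field_simps)
  then obtain q where q: "1 < q" "q < min 2 (2 * ln 2 / \<gamma>\<^sup>2)" using dense by blast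
  then have "\<gamma>\<^sup>2 * q / 2 < ln 2" using assms by (simp add: field_simps)
  then have "2 * weight_moment \<gamma> q < 1"
    unfolding two_weight_moment using q by (simp add: mult_pos_neg)
  then show thesis using q that[of q] by auto
qed

text \<open>Nondegeneracy, uniformly in the truncation depth. The mean is \<open>1 / 2\<close>, the part below \<open>1 / 8\<close> contributes at most
  \<open>1 / 8\<close>, and by the bounded \<open>q\<close>-th moment so does the part above some level \<open>m\<close>; the rest needs
  probability at least \<open>1 / (4 * m)\<close>. Markov's inequality at \<open>4 * m\<close> takes away only half of it.\<close>

lemma branch_mass_bulk:
  assumes "\<gamma> > 0" "\<gamma>\<^sup>2 < 2 * ln 2"
  obtains K \<kappa> where "K > 0" "\<kappa> > 0"
    "\<forall>i\<ge>2. \<forall>j. prob {\<omega> \<in> space M. 1 / 8 < branch_mass \<gamma> j i (env \<omega>) \<and> branch_mass \<gamma> j i (env \<omega>) \<le> K} \<ge> \<kappa>"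
proof -
  obtain q where q: "1 < q" "q \<le> 2" "2 * weight_moment \<gamma> q < 1"
    using subcritical_exponent[OF assms] .
  define C where "C = 9 / 4 / (1 - 2 * weight_moment \<gamma> q)"
  have "weight_moment \<gamma> q > 0" by (simp add: weight_moment_def)
  then have C: "C > 0" using q by (simp add: C_def)
  \<comment> \<open>Chosen such that \<open>C * m powr (1 - q) = 1 / 8\<close>.\<close>
  define m where "m = (8 * C) powr (1 / (q - 1))"
  have m: "m > 0" "m powr (1 - q) = 1 / (8 * C)"
  proof -
    show "m > 0" using C by (simp add: m_def)
    have "(1 / (q - 1)) * (1 - q) = -1" using q by (simp add: field_simps)
    then have "m powr (1 - q) = (8 * C) powr - 1"
      unfolding m_def powr_powr by (simp only:)
    also have "\<dots> = 1 / (8 * C)" using C by (simp only: powr_minus_divide) simp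
    finally show "m powr (1 - q) = 1 / (8 * C)" .
  qed
  have "1 / (8 * m) \<le> prob {\<omega> \<in> space M. 1 / 8 < branch_mass \<gamma> j i (env \<omega>) \<and> branch_mass \<gamma> j i (env \<omega>) \<le> 4 * m}"
    if i: "i \<ge> 2" for i j
  proof -
    define V where "V = (\<lambda>\<omega>. branch_mass \<gamma> j i (env \<omega>))"
    have [measurable]: "V \<in> borel_measurable M" using branch_mass_measurable[OF i] by (simp add: V_def)
    have pos: "V \<omega> > 0" for \<omega> by (simp add: V_def)
    have mean: "integrable M V" "expectation V = 1 / 2"
      using branch_mass_mean[OF i, of j] by (auto simp: V_def)
    have mom: "integrable M (\<lambda>\<omega>. V \<omega> powr q)" "expectation (\<lambda>\<omega>. V \<omega> powr q) \<le> C"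
      using branch_mass_moment[OF q i, of j] by (auto simp: V_def C_def)
    define A where "A = {\<omega> \<in> space M. 1 / 8 < V \<omega>}"
    have A[measurable]: "A \<in> events" unfolding A_def by measurable
    have le: "V \<omega> \<le> 1 / 8 + m * indicator A \<omega> + m powr (1 - q) * V \<omega> powr q" if "\<omega> \<in> space M" for \<omega>
    proof (cases "V \<omega> \<le> m")
      case True
      have "0 \<le> m powr (1 - q) * V \<omega> powr q" by (intro mult_nonneg_nonneg powr_ge_zero)
      then show ?thesis using that True m
        by (cases "\<omega> \<in> A") (auto simp: A_def)
    next
      case False
      have "V \<omega> = V \<omega> powr (1 - q) * V \<omega> powr q"
        using pos[of \<omega>] by (simp add: powr_add[symmetric])
      also have "\<dots> \<le> m powr (1 - q) * V \<omega> powr q"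
        using False m q by (intro mult_right_mono powr_mono2') auto
      finally have "V \<omega> \<le> m powr (1 - q) * V \<omega> powr q" .
      moreover have "0 \<le> m * indicator A \<omega>" using m by simp
      ultimately show ?thesis by linarith
    qed
    have "expectation V \<le> expectation (\<lambda>\<omega>. 1 / 8 + m * indicator A \<omega> + m powr (1 - q) * V \<omega> powr q)"
      by (intro integral_mono le) (use mean mom in \<open>auto simp: emeasure_eq_measure\<close>)
    also have "\<dots> = 1 / 8 + m * prob A + m powr (1 - q) * expectation (\<lambda>\<omega>. V \<omega> powr q)"
      using mean mom by (simp add: emeasure_eq_measure prob_space)
    also have "\<dots> \<le> 1 / 8 + m * prob A + m powr (1 - q) * C"
      using mom by (intro add_left_mono mult_left_mono) auto
    finally have "1 / 4 \<le> m * prob A" using mean C m(2) by simp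
    then have PA: "1 / (4 * m) \<le> prob A" using m by (simp add: field_simps)
    have "prob {\<omega> \<in> space M. 4 * m \<le> V \<omega>} \<le> expectation V / (4 * m)"
      by (rule integral_Markov_inequality_measure[where A = "{}"])
        (use mean m pos in \<open>auto intro!: AE_I2 less_imp_le[OF pos]\<close>)
    then have "prob {\<omega> \<in> space M. 4 * m \<le> V \<omega>} \<le> 1 / (8 * m)" using mean by simp
    moreover have "prob A \<le> prob {\<omega> \<in> space M. 1 / 8 < V \<omega> \<and> V \<omega> \<le> 4 * m} + prob {\<omega> \<in> space M. 4 * m \<le> V \<omega>}"
    proof -
      have "prob A \<le> prob ({\<omega> \<in> space M. 1 / 8 < V \<omega> \<and> V \<omega> \<le> 4 * m} \<union> {\<omega> \<in> space M. 4 * m \<le> V \<omega>})"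
        by (intro finite_measure_mono) (auto simp: A_def)
      also have "\<dots> \<le> prob {\<omega> \<in> space M. 1 / 8 < V \<omega> \<and> V \<omega> \<le> 4 * m} + prob {\<omega> \<in> space M. 4 * m \<le> V \<omega>}"
        by (intro measure_Un_le) measurable
      finally show ?thesis .
    qed
    ultimately have "1 / (4 * m) - 1 / (8 * m) \<le> prob {\<omega> \<in> space M. 1 / 8 < V \<omega> \<and> V \<omega> \<le> 4 * m}"
      using PA by linarith
    then show ?thesis using m by (simp add: V_def field_simps)
  qed
  then show thesis using m by (intro that[of "4 * m" "1 / (8 * m)"]) auto
qed

lemma path_weight_moment:
  "integrable M (\<lambda>\<omega>. path_weight \<gamma> i (env \<omega>) powr s) \<and>
   expectation (\<lambda>\<omega>. path_weight \<gamma> i (env \<omega>) powr s) = weight_moment \<gamma> s ^ floor_log i"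
proof (induction i rule: less_induct)
  case (less i)
  show ?case
  proof (cases "i < 2")
    case True
    then have "i = 0 \<or> i = 1" by auto
    then have "floor_log i = 0" by auto
    with True show ?thesis by (simp add: path_weight_simps prob_space)
  next
    case False
    then have i: "i \<ge> 2" by simp
    have IH: "integrable M (\<lambda>\<omega>. path_weight \<gamma> (i div 2) (env \<omega>) powr s)"
      "expectation (\<lambda>\<omega>. path_weight \<gamma> (i div 2) (env \<omega>) powr s) = weight_moment \<gamma> s ^ floor_log (i div 2)"
      using less[of "i div 2"] i by auto
    have w: "integrable M (\<lambda>\<omega>. weight \<gamma> (env \<omega> i) powr s)"
      "expectation (\<lambda>\<omega>. weight \<gamma> (env \<omega> i) powr s) = weight_moment \<gamma> s"
      using expectation_xi[OF i weight_powr_integral(1)] by (simp_all add: weight_powr_integral)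
    have ind: "indep_var borel (\<lambda>\<omega>. path_weight \<gamma> (i div 2) (env \<omega>) powr s) borel (\<lambda>\<omega>. weight \<gamma> (env \<omega> i) powr s)"
    proof (rule indep_var_blocks)
      show "{2..i div 2} \<inter> {i} = {}" using i by auto
      show "depends_on {2..i div 2} (\<lambda>x. path_weight \<gamma> (i div 2) x powr s)"
        by (rule depends_on_compose[OF depends_on_path_weight]) measurable
      show "depends_on {i} (\<lambda>x. weight \<gamma> (x i) powr s)"
        by (rule depends_on_compose[OF depends_on_coord]) auto
    qed (use i in auto)
    have eq: "path_weight \<gamma> i (env \<omega>) powr s = path_weight \<gamma> (i div 2) (env \<omega>) powr s * weight \<gamma> (env \<omega> i) powr s" for \<omega>
      using i by (simp add: path_weight_simps powr_mult)
    show ?thesis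
      unfolding eq indep_var_lebesgue_integral[OF ind IH(1) w(1)] IH(2) w(2)
      using indep_var_integrable[OF ind IH(1) w(1)] i by (simp add: floor_log_rec del: floor_log_half)
  qed
qed

text \<open>A Chernoff bound with negative exponents: \<open>- ln (path_weight)\<close> is a sum of independent variables of mean
  \<open>\<gamma>\<^sup>2 / 2 + ln 2\<close>.\<close>

lemma path_weight_lower:
  assumes "\<gamma> > 0" "b > \<gamma>\<^sup>2 / 2 + ln 2"
  obtains r where "0 < r" "r < 1"
    "\<forall>i. prob {\<omega> \<in> space M. path_weight \<gamma> i (env \<omega>) < exp (- b * real (floor_log i))} \<le> r ^ floor_log i"
proof -
  define a where "a = b - (\<gamma>\<^sup>2 / 2 + ln 2)"
  \<comment> \<open>The minimiser of the resulting exponent \<open>s * (s * \<gamma>\<^sup>2 / 2 - a)\<close>.\<close>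
  define s where "s = a / \<gamma>\<^sup>2"
  have a: "a > 0" and s: "s > 0" using assms by (auto simp: a_def s_def)
  define r where "r = weight_moment \<gamma> (- s) * exp (- s * b)"
  have "s * \<gamma>\<^sup>2 = a" using assms by (simp add: s_def)
  moreover have "r = exp (s * ((s * \<gamma>\<^sup>2) / 2 - a))"
    unfolding r_def weight_moment_def exp_add[symmetric] a_def by (simp add: algebra_simps)
  ultimately have "r = exp (s * (a / 2 - a))" by simp
  then have "r < 1" using a s by (simp add: mult_pos_neg)
  have "prob {\<omega> \<in> space M. path_weight \<gamma> i (env \<omega>) < exp (- b * real (floor_log i))} \<le> r ^ floor_log i" for i
  proof -
    let ?n = "floor_log i"
    let ?W = "\<lambda>\<omega>. path_weight \<gamma> i (env \<omega>)"
    note [measurable] = path_weight_measurable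
    have "prob {\<omega> \<in> space M. ?W \<omega> < exp (- b * real ?n)} \<le> prob {\<omega> \<in> space M. exp (s * b * real ?n) \<le> ?W \<omega> powr (- s)}"
    proof (intro finite_measure_mono subsetI CollectI conjI)
      fix \<omega> assume "\<omega> \<in> {\<omega> \<in> space M. ?W \<omega> < exp (- b * real ?n)}"
      then have "exp (- b * real ?n) powr (- s) \<le> ?W \<omega> powr (- s)"
        using s by (intro powr_mono2') auto
      then show "exp (s * b * real ?n) \<le> ?W \<omega> powr (- s)"
        by (simp add: powr_def mult_ac)
    qed auto
    also have "\<dots> \<le> expectation (\<lambda>\<omega>. ?W \<omega> powr (- s)) / exp (s * b * real ?n)"
      by (rule integral_Markov_inequality_measure[where A = "{}"]) (use path_weight_moment in auto)
    also have "\<dots> = weight_moment \<gamma> (- s) ^ ?n / exp (s * b) ^ ?n"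
      using path_weight_moment by (simp add: exp_of_nat_mult[symmetric] mult_ac)
    also have "\<dots> = r ^ ?n" by (simp add: r_def power_mult_distrib exp_minus divide_inverse power_inverse)
    finally show ?thesis .
  qed
  moreover have "0 < r" by (simp add: r_def weight_moment_def)
  ultimately show thesis using that[of r] \<open>r < 1\<close> by blast
qed

end

section \<open>The power-law tail of the subtree mass\<close>

lemma std_normal_tail_pos: "measure std_normal {x0..} > 0"
proof -
  interpret N: prob_space std_normal by (rule prob_space_std_normal)
  have "emeasure std_normal {x0..} \<noteq> 0"
  proof
    assume "emeasure std_normal {x0..} = 0"
    then have "{x0..} \<in> null_sets std_normal" by (simp add: null_sets_def)
    then have "AE x in lborel. x \<in> {x0..} \<longrightarrow> ennreal (std_normal_density x) = 0"
      by (subst (asm) null_sets_density_iff) auto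
    then have "AE x in lborel. x \<notin> {x0..}"
    proof eventually_elim
      case (elim x)
      then show ?case using normal_density_pos[of 1 0 x] by (auto simp: ennreal_eq_0_iff)
    qed
    then have "emeasure lborel {x0..} = 0"
      by (subst (asm) AE_iff_null_sets[symmetric]) auto
    then have "emeasure lborel {x0..x0 + 1} = 0"
      by (rule emeasure_eq_0[rotated]) auto
    then show False by simp
  qed
  then show ?thesis by (simp add: N.emeasure_eq_measure zero_less_measure_iff)
qed

context iid_normal_tree
begin

text \<open>Conditioning on the weight of \<open>i\<close>, in a form that asks only for a pointwise lower bound of the conditional
  probability.\<close>

lemma prob_weight_mult_ge:
  assumes "i \<ge> 2" "h \<in> borel_measurable borel" "\<And>x. 0 \<le> h x" "\<And>x. h x \<le> 1"
    and "\<And>x. h x \<le> prob {\<omega> \<in> space M. t / weight \<gamma> x < branch_mass \<gamma> j (2 * i) (env \<omega>) + branch_mass \<gamma> j (Suc (2 * i)) (env \<omega>)}"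
  shows "(\<integral>x. h x \<partial>std_normal) \<le> prob {\<omega> \<in> space M. t < branch_mass \<gamma> (Suc j) i (env \<omega>)}"
proof -
  interpret N: prob_space std_normal by (rule prob_space_std_normal)
  define U where "U = (\<lambda>\<omega>. branch_mass \<gamma> j (2 * i) (env \<omega>) + branch_mass \<gamma> j (Suc (2 * i)) (env \<omega>))"
  have U[measurable]: "U \<in> borel_measurable M"
    using assms(1) unfolding U_def by (intro borel_measurable_add branch_mass_measurable) auto
  have xi[measurable]: "(\<lambda>\<omega>. env \<omega> i) \<in> borel_measurable M"
    using xi_measurable[OF assms(1)] by (simp add: env_def)
  have distr: "distr M borel (\<lambda>\<omega>. env \<omega> i) = std_normal"
    using distr_xi[OF assms(1)] by (simp add: env_def)
  interpret U: prob_space "distr M borel U" by (rule prob_space_distr) simp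
  have "indep_var borel (\<lambda>\<omega>. env \<omega> i) borel U"
    unfolding U_def by (rule indep_node_children[OF assms(1) measurable_ident_sets[OF refl] measurable_ident_sets[OF refl]])
  then have joint: "std_normal \<Otimes>\<^sub>M distr M borel U = distr M (borel \<Otimes>\<^sub>M borel) (\<lambda>\<omega>. (env \<omega> i, U \<omega>))"
    unfolding indep_var_distribution_eq distr by blast
  define B where "B = {z :: real \<times> real. t < weight \<gamma> (fst z) * snd z}"
  have B[measurable]: "B \<in> sets (borel \<Otimes>\<^sub>M borel)"
  proof -
    have "{z \<in> space (borel \<Otimes>\<^sub>M borel). t < weight \<gamma> (fst z) * snd z} \<in> sets (borel \<Otimes>\<^sub>M borel)" by measurable
    then show ?thesis by (simp add: B_def space_pair_measure)
  qed
  have h_int: "integrable std_normal h"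
    by (rule N.integrable_const_bound[where B = 1]) (use assms in auto)
  have "ennreal (\<integral>x. h x \<partial>std_normal) = (\<integral>\<^sup>+x. ennreal (h x) \<partial>std_normal)"
    using h_int assms by (simp add: nn_integral_eq_integral)
  also have "\<dots> \<le> (\<integral>\<^sup>+x. emeasure (distr M borel U) (Pair x -` B) \<partial>std_normal)"
  proof (rule nn_integral_mono)
    fix x
    have "Pair x -` B = {t / weight \<gamma> x<..}"
      by (auto simp: B_def pos_divide_less_eq mult.commute)
    moreover have "emeasure (distr M borel U) {t / weight \<gamma> x<..} = ennreal (prob {\<omega> \<in> space M. t / weight \<gamma> x < U \<omega>})"
      by (subst emeasure_distr) (auto simp: emeasure_eq_measure intro!: arg_cong[where f = prob])
    ultimately show "ennreal (h x) \<le> emeasure (distr M borel U) (Pair x -` B)"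
      using assms(5)[of x] by (simp add: U_def)
  qed
  also have "\<dots> = emeasure (std_normal \<Otimes>\<^sub>M distr M borel U) B"
    by (rule U.emeasure_pair_measure_alt[symmetric]) (simp cong: sets_pair_measure_cong)
  also have "\<dots> = emeasure M ((\<lambda>\<omega>. (env \<omega> i, U \<omega>)) -` B \<inter> space M)"
    unfolding joint by (rule emeasure_distr) measurable
  also have "(\<lambda>\<omega>. (env \<omega> i, U \<omega>)) -` B \<inter> space M = {\<omega> \<in> space M. t < branch_mass \<gamma> (Suc j) i (env \<omega>)}"
    by (auto simp: B_def U_def)
  finally show ?thesis by (simp add: emeasure_eq_measure)
qed

text \<open>The sum exceeds \<open>s\<close> if one of the two independent positive summands does, which has probability at least
  \<open>1 - (1 - g)\<^sup>2\<close>.\<close>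

lemma prob_children_gt:
  assumes "i \<ge> 2" "0 \<le> g" "g \<le> \<delta>" "\<delta> \<le> 1"
    and "g \<le> prob {\<omega> \<in> space M. s < branch_mass \<gamma> j (2 * i) (env \<omega>)}"
    and "g \<le> prob {\<omega> \<in> space M. s < branch_mass \<gamma> j (Suc (2 * i)) (env \<omega>)}"
  shows "(2 - \<delta>) * g \<le> prob {\<omega> \<in> space M. s < branch_mass \<gamma> j (2 * i) (env \<omega>) + branch_mass \<gamma> j (Suc (2 * i)) (env \<omega>)}"
proof -
  let ?V0 = "\<lambda>\<omega>. branch_mass \<gamma> j (2 * i) (env \<omega>)" and ?V1 = "\<lambda>\<omega>. branch_mass \<gamma> j (Suc (2 * i)) (env \<omega>)"
  have [measurable]: "?V0 \<in> borel_measurable M" "?V1 \<in> borel_measurable M"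
    using assms(1) by (auto intro: branch_mass_measurable)
  have ind: "indep_var borel ?V0 borel ?V1"
    by (rule indep_siblings[OF assms(1) measurable_ident_sets[OF refl] measurable_ident_sets[OF refl]])
  have compl: "prob (V -` {..s} \<inter> space M) \<le> 1 - g"
    if [measurable]: "V \<in> borel_measurable M" and le: "g \<le> prob {\<omega> \<in> space M. s < V \<omega>}" for V
  proof -
    have "prob {\<omega> \<in> space M. \<not> s < V \<omega>} = 1 - prob {\<omega> \<in> space M. s < V \<omega>}"
      by (rule prob_neg) measurable
    moreover have "{\<omega> \<in> space M. \<not> s < V \<omega>} = V -` {..s} \<inter> space M" by auto
    ultimately show ?thesis using le by simp
  qed
  have "prob ((\<lambda>\<omega>. (?V0 \<omega>, ?V1 \<omega>)) -` ({..s} \<times> {..s}) \<inter> space M)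
      = prob (?V0 -` {..s} \<inter> space M) * prob (?V1 -` {..s} \<inter> space M)"
    by (rule indep_varD[OF ind]) auto
  also have "\<dots> \<le> (1 - g) * (1 - g)"
    using assms by (intro mult_mono compl) auto
  finally have both: "prob ((\<lambda>\<omega>. (?V0 \<omega>, ?V1 \<omega>)) -` ({..s} \<times> {..s}) \<inter> space M) \<le> (1 - g) * (1 - g)" .
  have "1 - prob {\<omega> \<in> space M. s < ?V0 \<omega> + ?V1 \<omega>} = prob {\<omega> \<in> space M. \<not> s < ?V0 \<omega> + ?V1 \<omega>}"
    by (rule prob_neg[symmetric]) measurable
  also have "\<dots> \<le> prob ((\<lambda>\<omega>. (?V0 \<omega>, ?V1 \<omega>)) -` ({..s} \<times> {..s}) \<inter> space M)"
  proof (intro finite_measure_mono subsetI)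
    fix \<omega> assume "\<omega> \<in> {\<omega> \<in> space M. \<not> s < ?V0 \<omega> + ?V1 \<omega>}"
    then show "\<omega> \<in> (\<lambda>\<omega>. (?V0 \<omega>, ?V1 \<omega>)) -` ({..s} \<times> {..s}) \<inter> space M"
      using branch_mass_pos[of \<gamma> j "2 * i" "env \<omega>"] branch_mass_pos[of \<gamma> j "Suc (2 * i)" "env \<omega>"]
      by (simp del: branch_mass_pos; linarith)
  qed measurable
  finally have "1 - (1 - g) * (1 - g) \<le> prob {\<omega> \<in> space M. s < ?V0 \<omega> + ?V1 \<omega>}"
    using both by linarith
  moreover have "(2 - \<delta>) * g \<le> (2 - g) * g" using assms by (intro mult_right_mono) auto
  ultimately show ?thesis by (simp add: algebra_simps)
qed

text \<open>A single large weight at the vertex itself makes its mass exceed any given level. The shift to \<open>Suc j\<close>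
  provides a child below that vertex.\<close>

lemma branch_mass_unbounded:
  assumes "\<gamma> > 0" "\<gamma>\<^sup>2 < 2 * ln 2" "L > 0"
  obtains \<theta> where "\<theta> > 0" "\<forall>i\<ge>2. \<forall>j. prob {\<omega> \<in> space M. L < branch_mass \<gamma> (Suc j) i (env \<omega>)} \<ge> \<theta>"
proof -
  obtain K \<kappa> where "K > 0" and \<kappa>: "\<kappa> > 0"
    "\<forall>i\<ge>2. \<forall>j. prob {\<omega> \<in> space M. 1 / 8 < branch_mass \<gamma> j i (env \<omega>) \<and> branch_mass \<gamma> j i (env \<omega>) \<le> K} \<ge> \<kappa>"
    using branch_mass_bulk[OF assms(1,2)] .
  have \<kappa>1: "\<kappa> \<le> 1" by (rule order_trans[OF \<kappa>(2)[rule_format, of 2 0] prob_le_1]) simp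
  define x0 where "x0 = (ln (8 * L) + (\<gamma>\<^sup>2 / 2 + ln 2)) / \<gamma>"
  have x0: "8 * L \<le> weight \<gamma> x" if "x \<ge> x0" for x
  proof -
    have "ln (8 * L) \<le> \<gamma> * x - (\<gamma>\<^sup>2 / 2 + ln 2)"
      using that assms by (simp add: x0_def pos_divide_le_eq mult.commute)
    then have "exp (ln (8 * L)) \<le> weight \<gamma> x" unfolding weight_def by (simp only: exp_le_cancel_iff)
    then show ?thesis using assms by simp
  qed
  have "\<kappa> * measure std_normal {x0..} \<le> prob {\<omega> \<in> space M. L < branch_mass \<gamma> (Suc j) i (env \<omega>)}"
    if i: "i \<ge> 2" for i j
  proof -
    have "(\<integral>x. \<kappa> * indicator {x0..} x \<partial>std_normal) \<le> prob {\<omega> \<in> space M. L < branch_mass \<gamma> (Suc j) i (env \<omega>)}"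
    proof (rule prob_weight_mult_ge[OF i])
      fix x
      have [measurable]: "(\<lambda>\<omega>. branch_mass \<gamma> j (2 * i) (env \<omega>)) \<in> borel_measurable M"
        "(\<lambda>\<omega>. branch_mass \<gamma> j (Suc (2 * i)) (env \<omega>)) \<in> borel_measurable M"
        using i by (auto intro: branch_mass_measurable)
      show "\<kappa> * indicator {x0..} x \<le> prob {\<omega> \<in> space M. L / weight \<gamma> x
          < branch_mass \<gamma> j (2 * i) (env \<omega>) + branch_mass \<gamma> j (Suc (2 * i)) (env \<omega>)}"
      proof (cases "x \<ge> x0")
        case True
        then have "L / weight \<gamma> x \<le> 1 / 8" using x0[of x] by (simp add: pos_divide_le_eq)
        have "prob {\<omega> \<in> space M. 1 / 8 < branch_mass \<gamma> j (2 * i) (env \<omega>) \<and> branch_mass \<gamma> j (2 * i) (env \<omega>) \<le> K}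
          \<le> prob {\<omega> \<in> space M. L / weight \<gamma> x
          < branch_mass \<gamma> j (2 * i) (env \<omega>) + branch_mass \<gamma> j (Suc (2 * i)) (env \<omega>)}"
        proof (intro finite_measure_mono subsetI)
          fix \<omega> assume "\<omega> \<in> {\<omega> \<in> space M. 1 / 8 < branch_mass \<gamma> j (2 * i) (env \<omega>) \<and> branch_mass \<gamma> j (2 * i) (env \<omega>) \<le> K}"
          then have "\<omega> \<in> space M" "1 / 8 < branch_mass \<gamma> j (2 * i) (env \<omega>)" by auto
          moreover have "0 < branch_mass \<gamma> j (Suc (2 * i)) (env \<omega>)" by simp
          ultimately show "\<omega> \<in> {\<omega> \<in> space M. L / weight \<gamma> x
            < branch_mass \<gamma> j (2 * i) (env \<omega>) + branch_mass \<gamma> j (Suc (2 * i)) (env \<omega>)}"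
            using \<open>L / weight \<gamma> x \<le> 1 / 8\<close> by (intro CollectI conjI) linarith+
        qed measurable
        from order_trans[OF \<kappa>(2)[rule_format, of "2 * i" j] this] show ?thesis using i True by simp
      qed simp
    qed (use \<kappa> \<kappa>1 in \<open>auto simp: indicator_def\<close>)
    then show ?thesis by simp
  qed
  then show thesis using \<kappa>(1) std_normal_tail_pos by (intro that[of "\<kappa> * measure std_normal {x0..}"]) auto
qed

lemma tail_profile_vanishes:
  assumes "p > 1" "e > 0" "t \<ge> (1 / e) powr (1 / (p - 1))" "B \<ge> 1"
  shows "tail_profile p B e t = 0"
proof -
  have "(1 / e) powr (1 / (p - 1)) > 0" using assms by simp
  then have t: "t > 0" using assms by linarith
  have "1 / e = ((1 / e) powr (1 / (p - 1))) powr (p - 1)"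
    unfolding powr_powr using assms by simp
  also have "\<dots> \<le> t powr (p - 1)"
    using assms by (intro powr_mono2) auto
  finally have "1 / e \<le> t powr (p - 1)" .
  then have "1 \<le> e * t powr (p - 1)" using assms by (simp add: pos_divide_le_eq mult.commute)
  then have "t powr - p * 1 \<le> t powr - p * (e * t powr (p - 1))" by (intro mult_left_mono) auto
  also have "\<dots> = e * (t powr - p * t powr (p - 1))" by simp
  also have "\<dots> = e * t powr (- p + (p - 1))" by (simp only: powr_add)
  also have "\<dots> = e / t" using t by (simp add: powr_minus_divide)
  finally have "(t powr - p - e / t) / B \<le> 0" using assms by (simp add: divide_nonpos_pos)
  then show ?thesis by (simp add: tail_profile_def)
qed

text \<open>The comparison argument. If the tails at depth \<open>j\<close> dominate \<open>\<kappa> * a\<close> times the profile, then those at depth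
  \<open>j + 1\<close> dominate \<open>\<kappa> * min 1 ((1 + \<rho>) * a)\<close> times the profile: for \<open>t \<ge> 1\<close> by the subsolution property,
  for \<open>t < 1\<close> because the tails are at least \<open>\<kappa>\<close> there. The argument starts with some \<open>a > 0\<close>, since the
  profile has bounded support, and reaches \<open>a = 1\<close> after finitely many steps. The depth needed depends on
  \<open>t\<close>, but \<open>c\<close> does not.\<close>

lemma branch_mass_tail:
  assumes "\<gamma> > 0" "\<gamma>\<^sup>2 < 2 * ln 2" "\<gamma>\<^sup>2 * p / 2 > ln 2"
  obtains c where "c > 0"
    "\<forall>t\<ge>1. \<exists>J. \<forall>j\<ge>J. \<forall>i\<ge>2. c * t powr - p \<le> prob {\<omega> \<in> space M. t < branch_mass \<gamma> j i (env \<omega>)}"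
proof -
  have p: "p > 1"
  proof (rule ccontr)
    assume "\<not> p > 1"
    then have "\<gamma>\<^sup>2 * p \<le> \<gamma>\<^sup>2 * 1" by (intro mult_left_mono) auto
    then show False using assms by linarith
  qed
  obtain \<delta> B \<rho> where sub: "0 < \<delta>" "\<delta> \<le> 1" "B \<ge> 1" "\<rho> > 0"
    "\<forall>e\<ge>0. \<forall>t\<ge>1. (1 + \<rho>) * tail_profile p B e t \<le> (2 - \<delta>) * (\<integral>x. tail_profile p B e (t / weight \<gamma> x) \<partial>std_normal)"
    using tail_profile_subsolution[OF p assms(3)] .
  define P where "P = (\<lambda>j i t. prob {\<omega> \<in> space M. t < branch_mass \<gamma> j i (env \<omega>)})"
  have P_antimono: "P j i t \<le> P j i s" if "s \<le> t" "i \<ge> 2" for j i s t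
    unfolding P_def using branch_mass_measurable[OF that(2), of j, measurable] that
    by (intro finite_measure_mono) auto
  obtain \<theta>1 where \<theta>1: "\<theta>1 > 0" "\<forall>i\<ge>2. \<forall>j. P (Suc j) i 1 \<ge> \<theta>1"
    using branch_mass_unbounded[OF assms(1,2) zero_less_one] unfolding P_def by blast
  define \<kappa> where "\<kappa> = min \<delta> \<theta>1"
  have \<kappa>: "\<kappa> > 0" "\<kappa> \<le> \<delta>" "\<kappa> \<le> 1" using sub \<theta>1 by (auto simp: \<kappa>_def)
  have step: "\<kappa> * min 1 ((1 + \<rho>) * a) * tail_profile p B e t \<le> P (Suc (Suc j)) i t"
    if hyp: "\<And>i t. i \<ge> 2 \<Longrightarrow> t > 0 \<Longrightarrow> \<kappa> * a * tail_profile p B e t \<le> P (Suc j) i t"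
      and a: "0 \<le> a" "a \<le> 1" and e: "e \<ge> 0" and i: "i \<ge> 2" for a e i j t
  proof (cases "t \<ge> 1")
    case False
    have "\<kappa> * min 1 ((1 + \<rho>) * a) * tail_profile p B e t \<le> \<kappa> * 1 * 1"
      using \<kappa> a sub(4) by (intro mult_mono tail_profile_bounds mult_nonneg_nonneg) auto
    also have "\<dots> \<le> P (Suc (Suc j)) i 1" using \<theta>1(2) i by (auto simp: \<kappa>_def min.coboundedI2)
    also have "\<dots> \<le> P (Suc (Suc j)) i t" using False i by (intro P_antimono) auto
    finally show ?thesis .
  next
    case True
    have \<kappa>a: "0 \<le> \<kappa> * a" "\<kappa> * a \<le> \<delta>" using \<kappa> a mult_mono[of \<kappa> \<delta> a 1] by auto
    have "(\<integral>x. (2 - \<delta>) * (\<kappa> * a * tail_profile p B e (t / weight \<gamma> x)) \<partial>std_normal) \<le> P (Suc (Suc j)) i t"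
      unfolding P_def
    proof (rule prob_weight_mult_ge[OF i])
      fix x
      let ?s = "t / weight \<gamma> x"
      have s: "?s > 0" using True weight_pos[of \<gamma> x] by (simp add: divide_pos_pos)
      have g: "0 \<le> \<kappa> * a * tail_profile p B e ?s" "\<kappa> * a * tail_profile p B e ?s \<le> \<delta>"
        using \<kappa>a tail_profile_bounds[of p B e ?s] mult_mono[of "\<kappa> * a" \<delta> "tail_profile p B e ?s" 1] sub(1) by auto
      show "0 \<le> (2 - \<delta>) * (\<kappa> * a * tail_profile p B e ?s)"
        using sub(2) by (intro mult_nonneg_nonneg[OF _ g(1)]) simp
      have hyp': "\<kappa> * a * tail_profile p B e ?s \<le> P (Suc j) (2 * i) ?s"
        "\<kappa> * a * tail_profile p B e ?s \<le> P (Suc j) (Suc (2 * i)) ?s"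
        using i s by (auto intro!: hyp)
      show le: "(2 - \<delta>) * (\<kappa> * a * tail_profile p B e ?s) \<le> prob {\<omega> \<in> space M. ?s <
          branch_mass \<gamma> (Suc j) (2 * i) (env \<omega>) + branch_mass \<gamma> (Suc j) (Suc (2 * i)) (env \<omega>)}"
        by (rule prob_children_gt[OF i g sub(2) hyp'[unfolded P_def]])
      show "(2 - \<delta>) * (\<kappa> * a * tail_profile p B e ?s) \<le> 1"
        by (rule order_trans[OF le prob_le_1])
    qed measurable
    then have "\<kappa> * a * ((2 - \<delta>) * (\<integral>x. tail_profile p B e (t / weight \<gamma> x) \<partial>std_normal)) \<le> P (Suc (Suc j)) i t"
      by (simp add: mult_ac)
    moreover have "\<kappa> * a * ((1 + \<rho>) * tail_profile p B e t)
      \<le> \<kappa> * a * ((2 - \<delta>) * (\<integral>x. tail_profile p B e (t / weight \<gamma> x) \<partial>std_normal))"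
      using sub(5) e True \<kappa>a by (intro mult_left_mono) auto
    moreover have "\<kappa> * min 1 ((1 + \<rho>) * a) * tail_profile p B e t \<le> \<kappa> * ((1 + \<rho>) * a) * tail_profile p B e t"
      using \<kappa> by (intro mult_right_mono mult_left_mono tail_profile_bounds) auto
    ultimately show ?thesis by (simp add: mult_ac)
  qed
  have profile: "\<exists>J. \<forall>j\<ge>J. \<forall>i\<ge>2. \<forall>t>0. \<kappa> * tail_profile p B e t \<le> P j i t" if e: "e > 0" for e
  proof -
    define L where "L = (1 / e) powr (1 / (p - 1))"
    have "L > 0" using e by (simp add: L_def)
    then obtain \<theta> where \<theta>: "\<theta> > 0" "\<forall>i\<ge>2. \<forall>j. P (Suc j) i L \<ge> \<theta>"
      using branch_mass_unbounded[OF assms(1,2), of L] unfolding P_def by blast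
    define a where "a = (\<lambda>r. min 1 ((1 + \<rho>) ^ r * \<theta>))"
    have a: "0 \<le> a r" "a r \<le> 1" for r using \<theta> sub(4) by (auto simp: a_def)
    have a_Suc: "a (Suc r) \<le> min 1 ((1 + \<rho>) * a r)" for r
      using sub(4) \<theta> by (auto simp: a_def min_def mult_ac)
    have "\<kappa> * a r * tail_profile p B e t \<le> P (Suc j) i t" if "j \<ge> r" "i \<ge> 2" "t > 0" for r j i t
      using that
    proof (induction r arbitrary: j i t)
      case 0
      show ?case
      proof (cases "t \<ge> L")
        case True
        then have "tail_profile p B e t = 0"
          using p e sub(3) unfolding L_def by (intro tail_profile_vanishes) auto
        then show ?thesis by (simp add: P_def)
      next
        case False
        have "\<kappa> * a 0 * tail_profile p B e t \<le> 1 * \<theta> * 1"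
          using \<kappa> a[of 0] \<theta> by (intro mult_mono tail_profile_bounds) (auto simp: a_def)
        also have "\<dots> \<le> P (Suc j) i L" using \<theta>(2) 0 by simp
        also have "\<dots> \<le> P (Suc j) i t" using False 0 by (intro P_antimono) auto
        finally show ?thesis .
      qed
    next
      case (Suc r)
      obtain j' where j: "j = Suc j'" "j' \<ge> r" using Suc.prems(1) by (cases j) auto
      have "\<kappa> * a (Suc r) * tail_profile p B e t \<le> \<kappa> * min 1 ((1 + \<rho>) * a r) * tail_profile p B e t"
        using \<kappa> by (intro mult_right_mono mult_left_mono tail_profile_bounds a_Suc) auto
      also have "\<dots> \<le> P (Suc j) i t"
        unfolding j(1) using Suc.IH[OF j(2)] a Suc.prems e by (intro step) auto
      finally show ?case .
    qed
    moreover obtain r where "1 / \<theta> < (1 + \<rho>) ^ r"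
      using real_arch_pow[of "1 + \<rho>"] sub(4) by auto
    then have "a r = 1" using \<theta>(1) by (auto simp: a_def pos_divide_less_eq)
    ultimately have "\<kappa> * tail_profile p B e t \<le> P j i t" if "j \<ge> Suc r" "i \<ge> 2" "t > 0" for j i t
      using that by (cases j) (auto, metis mult.right_neutral)
    then show ?thesis by blast
  qed
  have "\<exists>J. \<forall>j\<ge>J. \<forall>i\<ge>2. \<kappa> / (2 * B) * t powr - p \<le> P j i t" if t: "t \<ge> 1" for t
  proof -
    \<comment> \<open>The cut-off then removes exactly half of the power law at \<open>t\<close>.\<close>
    define e where "e = t * t powr - p / 2"
    have e: "e > 0" using t by (simp add: e_def)
    have "t powr - p \<le> 1" using t p by (simp add: powr_minus inverse_le_1_iff ge_one_powr_ge_zero)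
    then have "t powr - p / (2 * B) \<le> 1" using sub(3) by (simp add: pos_divide_le_eq)
    moreover have "(t powr - p - e / t) / B = t powr - p / (2 * B)"
      using t sub(3) by (simp add: e_def field_simps)
    ultimately have "tail_profile p B e t = t powr - p / (2 * B)"
      using sub(3) by (simp add: tail_profile_def)
    then have eq: "\<kappa> / (2 * B) * t powr - p = \<kappa> * tail_profile p B e t" by simp
    show ?thesis unfolding eq using profile[OF e] t by (meson less_le_trans zero_less_one)
  qed
  then have tail: "\<forall>t\<ge>1. \<exists>J. \<forall>j\<ge>J. \<forall>i\<ge>2. \<kappa> / (2 * B) * t powr - p \<le> P j i t"
    by blast
  show thesis
    by (rule that[OF _ tail[unfolded P_def]]) (use \<kappa> sub(3) in simp)
qed

end

section \<open>Vertices with a heavy and a moderate child\<close>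

text \<open>In probabilistic terms: the event that some trial succeeds is split according to the first success.\<close>

lemma sum_first_success:
  fixes s :: "nat \<Rightarrow> real"
  assumes "a \<le> m"
  shows "(\<Sum>v\<in>{a..<m}. s v * (\<Prod>u\<in>{a..<v}. 1 - s u)) = 1 - (\<Prod>u\<in>{a..<m}. 1 - s u)"
  using assms
proof (induction m rule: dec_induct)
  case (step m)
  then show ?case by (simp add: algebra_simps)
qed simp

context iid_normal_tree
begin

text \<open>The indicator that the subtree below \<open>v\<close> is suitable: left child heavy, right child of moderate mass. As a real
  valued function it can be multiplied and averaged directly.\<close>

definition success :: "real \<Rightarrow> real \<Rightarrow> nat \<Rightarrow> nat \<Rightarrow> (nat \<Rightarrow> real) \<Rightarrow> real" where
  "success t K j v x =
    indicator {t<..} (branch_mass \<gamma> j (2 * v) x) * indicator {1 / 8<..K} (branch_mass \<gamma> j (Suc (2 * v)) x)"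

lemma success_range: "0 \<le> success t K j v x" "success t K j v x \<le> 1"
  by (auto simp: success_def indicator_def)

lemma depends_on_success:
  "depends_on (subtree (2 * v) \<union> subtree (Suc (2 * v))) (success t K j v)"
  unfolding success_def[abs_def]
  by (intro depends_on_mult depends_on_compose[OF depends_on_mono[OF depends_on_branch_mass]]) auto

lemma success_probability:
  assumes "v \<ge> 2"
    and "a \<le> prob {\<omega> \<in> space M. t < branch_mass \<gamma> j (2 * v) (env \<omega>)}"
    and "\<kappa> \<le> prob {\<omega> \<in> space M. 1 / 8 < branch_mass \<gamma> j (Suc (2 * v)) (env \<omega>) \<and> branch_mass \<gamma> j (Suc (2 * v)) (env \<omega>) \<le> K}"
    and "0 \<le> a" "0 \<le> \<kappa>"
  shows "a * \<kappa> \<le> expectation (\<lambda>\<omega>. success t K j v (env \<omega>))"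
proof -
  let ?V0 = "\<lambda>\<omega>. branch_mass \<gamma> j (2 * v) (env \<omega>)" and ?V1 = "\<lambda>\<omega>. branch_mass \<gamma> j (Suc (2 * v)) (env \<omega>)"
  have [measurable]: "?V0 \<in> borel_measurable M" "?V1 \<in> borel_measurable M"
    using assms(1) by (auto intro: branch_mass_measurable)
  have ind: "indep_var borel (\<lambda>\<omega>. indicator {t<..} (?V0 \<omega>) :: real) borel (\<lambda>\<omega>. indicator {1 / 8<..K} (?V1 \<omega>) :: real)"
    by (rule indep_siblings[OF assms(1)]) measurable
  have ind0: "(\<lambda>\<omega>. indicator {t<..} (?V0 \<omega>) :: real) \<in> borel_measurable M"
    "(\<lambda>\<omega>. indicator {1 / 8<..K} (?V1 \<omega>) :: real) \<in> borel_measurable M" by measurable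
  have int: "integrable M (\<lambda>\<omega>. indicator {t<..} (?V0 \<omega>) :: real)" "integrable M (\<lambda>\<omega>. indicator {1 / 8<..K} (?V1 \<omega>) :: real)"
    by (rule integrable_const_bound[where B = 1]; simp add: ind0 indicator_def)+
  have E0: "expectation (\<lambda>\<omega>. indicator {t<..} (?V0 \<omega>) :: real) = prob {\<omega> \<in> space M. t < ?V0 \<omega>}"
  proof -
    have "expectation (\<lambda>\<omega>. indicator {t<..} (?V0 \<omega>) :: real) = expectation (indicator {\<omega> \<in> space M. t < ?V0 \<omega>})"
      by (rule Bochner_Integration.integral_cong) (auto simp: indicator_def)
    then show ?thesis by simp
  qed
  have E1: "expectation (\<lambda>\<omega>. indicator {1 / 8<..K} (?V1 \<omega>) :: real) = prob {\<omega> \<in> space M. 1 / 8 < ?V1 \<omega> \<and> ?V1 \<omega> \<le> K}"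
  proof -
    have "expectation (\<lambda>\<omega>. indicator {1 / 8<..K} (?V1 \<omega>) :: real) = expectation (indicator {\<omega> \<in> space M. 1 / 8 < ?V1 \<omega> \<and> ?V1 \<omega> \<le> K})"
      by (rule Bochner_Integration.integral_cong) (auto simp: indicator_def)
    then show ?thesis by simp
  qed
  show ?thesis
    unfolding success_def indep_var_lebesgue_integral[OF ind int] E0 E1
    using assms by (intro mult_mono) auto
qed

text \<open>The first success among the vertices of a level is determined by the subtrees below this level, hence
  independent of the weight of the path leading to it. So the weight condition costs only the factor
  \<open>1 - d\<close>, although \<open>d\<close> bounds the failure for one vertex and not for the exponentially many vertices together.\<close>

lemma first_success_bound:
  assumes n: "n \<ge> 1" and q: "0 \<le> q"
    and success: "\<And>v. v \<in> {2 ^ n..<2 ^ Suc n} \<Longrightarrow> q \<le> expectation (\<lambda>\<omega>. success t K j v (env \<omega>))"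
    and path: "\<And>v. v \<in> {2 ^ n..<2 ^ Suc n} \<Longrightarrow> prob {\<omega> \<in> space M. path_weight \<gamma> v (env \<omega>) < l} \<le> d"
    and d: "d \<le> 1"
  shows "(1 - d) * (1 - exp (- q * 2 ^ n)) \<le> prob {\<omega> \<in> space M. \<exists>v\<in>{2 ^ n..<2 ^ Suc n}. l \<le> path_weight \<gamma> v (env \<omega>) \<and>
    t < branch_mass \<gamma> j (2 * v) (env \<omega>) \<and> 1 / 8 < branch_mass \<gamma> j (Suc (2 * v)) (env \<omega>) \<and> branch_mass \<gamma> j (Suc (2 * v)) (env \<omega>) \<le> K}"
    (is "_ \<le> prob ?E")
proof -
  let ?I = "{2 ^ n..<2 ^ Suc n :: nat}"
  have I2: "v \<ge> 2" if "v \<in> ?I" for v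
    using that n power_increasing[of 1 n "2::nat"] by auto
  define S where "S = (\<lambda>v \<omega>. success t K j v (env \<omega>))"
  define F where "F = (\<lambda>v \<omega>. S v \<omega> * (\<Prod>u\<in>{2 ^ n..<v}. 1 - S u \<omega>))"
  define w where "w = (\<lambda>v \<omega>. indicator {l..} (path_weight \<gamma> v (env \<omega>)) :: real)"
  have S_range: "0 \<le> S v \<omega>" "S v \<omega> \<le> 1" for v \<omega> by (simp_all add: S_def success_range)
  have F_range: "0 \<le> F v \<omega>" "F v \<omega> \<le> 1" for v \<omega>
    unfolding F_def using S_range by (auto intro!: mult_nonneg_nonneg prod_nonneg mult_le_one prod_le_1)
  have level: "floor_log v = n" if "v \<in> ?I" for v
    using that by (intro floor_log_eqI) auto
  have low: "subtree (2 * v) \<union> subtree (Suc (2 * v)) \<subseteq> {2 ^ Suc n..}" if "v \<in> ?I" for v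
    using that subtree_ge[of "2 * v"] subtree_ge[of "Suc (2 * v)"] by fastforce
  have two: "{2 ^ Suc n..} \<subseteq> {2::nat..}"
    using power_increasing[of 1 "Suc n" "2::nat"] by auto
  have dep_F: "depends_on {2 ^ Suc n..} (\<lambda>x. success t K j v x * (\<Prod>u\<in>{2 ^ n..<v}. 1 - success t K j u x))"
    if "v \<in> ?I" for v
  proof (intro depends_on_mult depends_on_prod)
    have dep: "depends_on {2 ^ Suc n..} (success t K j u)" if "u \<in> ?I" for u
      by (rule depends_on_mono[OF depends_on_success low[OF that]])
    show "depends_on {2 ^ Suc n..} (success t K j v)" by (rule dep[OF that])
    fix u assume "u \<in> {2 ^ n..<v}"
    then have "u \<in> ?I" using that by auto
    then show "depends_on {2 ^ Suc n..} (\<lambda>x. 1 - success t K j u x)"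
      by (intro depends_on_compose[OF dep, of u "\<lambda>y. 1 - y"]) auto
  qed
  have F_meas: "F v \<in> borel_measurable M" if "v \<in> ?I" for v
    using depends_on_measurable[OF two dep_F[OF that]] by (simp add: F_def S_def)
  have S_meas: "S v \<in> borel_measurable M" if "v \<in> ?I" for v
    unfolding S_def by (rule depends_on_measurable[OF order_trans[OF low[OF that] two] depends_on_success])
  have w_meas: "w v \<in> borel_measurable M" for v
    unfolding w_def using path_weight_measurable[of v] by measurable
  have F_int: "integrable M (F v)" if "v \<in> ?I" for v
    by (rule integrable_const_bound[where B = 1]) (use F_range F_meas[OF that] in auto)
  have S_int: "integrable M (S v)" if "v \<in> ?I" for v
    by (rule integrable_const_bound[where B = 1]) (use S_range S_meas[OF that] in auto)
  have w_int: "integrable M (w v)" for v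
    by (rule integrable_const_bound[where B = 1]) (use w_meas in \<open>auto simp: w_def indicator_def\<close>)
  have ind: "indep_var borel (F v) borel (w v)" if "v \<in> ?I" for v
    unfolding F_def S_def w_def
  proof (rule indep_var_blocks[OF _ two _ dep_F[OF that]])
    show "{2 ^ Suc n..} \<inter> {2..v} = {}" using that by auto
    show "depends_on {2..v} (\<lambda>x. indicator {l..} (path_weight \<gamma> v x))"
      by (rule depends_on_compose[OF depends_on_path_weight]) measurable
  qed auto
  have w_ge: "1 - d \<le> expectation (w v)" if "v \<in> ?I" for v
  proof -
    note [measurable] = path_weight_measurable
    have "expectation (w v) = expectation (indicator {\<omega> \<in> space M. \<not> path_weight \<gamma> v (env \<omega>) < l})"
      unfolding w_def by (rule Bochner_Integration.integral_cong) (auto simp: indicator_def)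
    also have "\<dots> = prob {\<omega> \<in> space M. \<not> path_weight \<gamma> v (env \<omega>) < l}" by simp
    also have "\<dots> = 1 - prob {\<omega> \<in> space M. path_weight \<gamma> v (env \<omega>) < l}"
      by (rule prob_neg) measurable
    finally show ?thesis using path[OF that] by simp
  qed
  have none: "expectation (\<lambda>\<omega>. \<Prod>u\<in>?I. 1 - S u \<omega>) \<le> exp (- q * 2 ^ n)"
  proof -
    have "disjoint_family_on (\<lambda>v. subtree v) ?I"
      unfolding disjoint_family_on_def using level I2 by (intro ballI impI subtree_disjoint) fastforce+
    then have "indep_vars (\<lambda>_. borel) (\<lambda>v \<omega>. 1 - success t K j v (env \<omega>)) ?I"
    proof (rule indep_vars_blocks)
      fix v assume v: "v \<in> ?I"
      show "subtree v \<subseteq> {2..}" using subtree_ge[of v] I2[OF v] by auto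
      show "depends_on (subtree v) (\<lambda>x. 1 - success t K j v x)"
        using subtree_child[of v]
        by (intro depends_on_compose[OF depends_on_mono[OF depends_on_success], of _ _ "\<lambda>y. 1 - y"]) auto
    qed
    then have "expectation (\<lambda>\<omega>. \<Prod>u\<in>?I. 1 - S u \<omega>) = (\<Prod>u\<in>?I. expectation (\<lambda>\<omega>. 1 - S u \<omega>))"
      using S_int unfolding S_def by (intro indep_vars_lebesgue_integral) auto
    also have "\<dots> \<le> (\<Prod>u\<in>?I. exp (- q))"
    proof (rule prod_mono)
      fix u assume u: "u \<in> ?I"
      have "expectation (\<lambda>\<omega>. 1 - S u \<omega>) = 1 - expectation (S u)"
        using S_int[OF u] by (simp add: prob_space)
      also have "\<dots> \<le> 1 + (- q)" using success[OF u] by (simp add: S_def)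
      also have "\<dots> \<le> exp (- q)" by (rule exp_ge_add_one_self)
      finally show "0 \<le> expectation (\<lambda>\<omega>. 1 - S u \<omega>) \<and> expectation (\<lambda>\<omega>. 1 - S u \<omega>) \<le> exp (- q)"
        using S_range by (auto intro!: Bochner_Integration.integral_nonneg)
    qed
    also have "\<dots> = exp (- q) ^ (2 ^ n)" by simp
    also have "\<dots> = exp (- q * 2 ^ n)" by (simp add: exp_of_nat_mult[symmetric] mult_ac)
    finally show ?thesis .
  qed
  have E: "?E \<in> events"
  proof -
    have [measurable]: "(\<lambda>\<omega>. branch_mass \<gamma> j (2 * v) (env \<omega>)) \<in> borel_measurable M"
      "(\<lambda>\<omega>. branch_mass \<gamma> j (Suc (2 * v)) (env \<omega>)) \<in> borel_measurable M" if "v \<in> ?I" for v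
      using I2[OF that] by (auto intro: branch_mass_measurable)
    note [measurable] = path_weight_measurable
    show ?thesis by measurable
  qed
  have below: "(\<Sum>v\<in>?I. F v \<omega> * w v \<omega>) \<le> indicator ?E \<omega>" if \<omega>: "\<omega> \<in> space M" for \<omega>
  proof (cases "\<omega> \<in> ?E")
    case True
    have "(\<Sum>v\<in>?I. F v \<omega> * w v \<omega>) \<le> (\<Sum>v\<in>?I. F v \<omega>)"
      using F_range by (intro sum_mono) (auto simp: w_def indicator_def)
    also have "\<dots> = 1 - (\<Prod>u\<in>?I. 1 - S u \<omega>)"
      unfolding F_def by (rule sum_first_success) simp
    also have "\<dots> \<le> 1" using S_range by (simp add: prod_nonneg)
    finally show ?thesis using True by simp
  next
    case False
    have "F v \<omega> * w v \<omega> = 0" if v: "v \<in> ?I" for v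
      using False v \<omega> by (auto simp: F_def S_def w_def success_def indicator_def)
    then have "(\<Sum>v\<in>?I. F v \<omega> * w v \<omega>) = 0" by (intro sum.neutral) blast
    then show ?thesis by (simp only: indicator_pos_le)
  qed
  have sum_F: "expectation (\<lambda>\<omega>. \<Sum>v\<in>?I. F v \<omega>) = 1 - expectation (\<lambda>\<omega>. \<Prod>u\<in>?I. 1 - S u \<omega>)"
  proof -
    have "integrable M (\<lambda>\<omega>. \<Prod>u\<in>?I. 1 - S u \<omega>)"
      by (rule integrable_const_bound[where B = 1])
        (use S_range S_meas in \<open>auto intro!: AE_I2 prod_le_1 borel_measurable_prod simp: abs_prod\<close>)
    moreover have "(\<Sum>v\<in>?I. F v \<omega>) = 1 - (\<Prod>u\<in>?I. 1 - S u \<omega>)" for \<omega>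
      unfolding F_def by (rule sum_first_success) simp
    ultimately show ?thesis by (simp add: prob_space)
  qed
  have "(1 - d) * (1 - exp (- q * 2 ^ n)) \<le> (1 - d) * (1 - expectation (\<lambda>\<omega>. \<Prod>u\<in>?I. 1 - S u \<omega>))"
    using none d by (intro mult_left_mono) auto
  also have "\<dots> = (\<Sum>v\<in>?I. expectation (F v) * (1 - d))"
    unfolding sum_F[symmetric] using F_int by (simp add: sum_distrib_left mult.commute)
  also have "\<dots> \<le> (\<Sum>v\<in>?I. expectation (F v) * expectation (w v))"
    using w_ge F_range by (intro sum_mono mult_left_mono Bochner_Integration.integral_nonneg) auto
  also have "\<dots> = (\<Sum>v\<in>?I. expectation (\<lambda>\<omega>. F v \<omega> * w v \<omega>))"
    using indep_var_lebesgue_integral[OF ind F_int w_int] by simp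
  also have "\<dots> = expectation (\<lambda>\<omega>. \<Sum>v\<in>?I. F v \<omega> * w v \<omega>)"
    using indep_var_integrable[OF ind F_int w_int] by (subst Bochner_Integration.integral_sum) auto
  also have "\<dots> \<le> expectation (indicator ?E)"
  proof (rule integral_mono[OF _ _ below])
    show "integrable M (\<lambda>\<omega>. \<Sum>v\<in>?I. F v \<omega> * w v \<omega>)"
      using indep_var_integrable[OF ind F_int w_int] by (intro Bochner_Integration.integrable_sum) auto
    show "integrable M (indicator ?E :: 'w \<Rightarrow> real)"
      by (rule integrable_real_indicator[OF E]) (simp add: emeasure_eq_measure)
  qed
  also have "\<dots> = prob ?E" using E by simp
  finally show ?thesis .
qed

text \<open>With \<open>t = exp (c * n)\<close> a single subtree succeeds with probability at least of order \<open>exp (- c * p * n)\<close>, and there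
  are \<open>exp (n * ln 2)\<close> of them; \<open>c < \<gamma>\<^sup>2 / 2\<close> leaves room for an admissible \<open>p\<close> with \<open>c * p < ln 2\<close>.\<close>

lemma good_vertex_probability:
  assumes "\<gamma> > 0" "\<gamma>\<^sup>2 < 2 * ln 2" "b > \<gamma>\<^sup>2 / 2 + ln 2" "0 < c" "c < \<gamma>\<^sup>2 / 2"
  obtains K lo where "K > 0" "lo \<longlonglongrightarrow> 1"
    "\<forall>n\<ge>1. \<exists>J. \<forall>j\<ge>J. lo n \<le> prob {\<omega> \<in> space M. \<exists>v\<in>{2 ^ n..<2 ^ Suc n}.
      exp (- b * real n) \<le> path_weight \<gamma> v (env \<omega>) \<and> exp (c * real n) < branch_mass \<gamma> j (2 * v) (env \<omega>) \<and>
      1 / 8 < branch_mass \<gamma> j (Suc (2 * v)) (env \<omega>) \<and> branch_mass \<gamma> j (Suc (2 * v)) (env \<omega>) \<le> K}"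
proof -
  \<comment> \<open>The open interval from which the tail exponent is taken.\<close>
  have "2 * ln 2 / \<gamma>\<^sup>2 < ln 2 / c"
    using assms by (simp add: frac_less2 field_simps)
  then obtain p where "2 * ln 2 / \<gamma>\<^sup>2 < p" "p < ln 2 / c" using dense by blast
  then have p: "\<gamma>\<^sup>2 * p / 2 > ln 2" "c * p < ln 2" using assms by (simp_all add: field_simps)
  obtain c0 where c0: "c0 > 0" "\<forall>t\<ge>1. \<exists>J. \<forall>j\<ge>J. \<forall>i\<ge>2. c0 * t powr - p \<le> prob {\<omega> \<in> space M. t < branch_mass \<gamma> j i (env \<omega>)}"
    using branch_mass_tail[OF assms(1,2) p(1)] .
  obtain K \<kappa> where K: "K > 0" "\<kappa> > 0" "\<forall>i\<ge>2. \<forall>j. prob {\<omega> \<in> space M. 1 / 8 < branch_mass \<gamma> j i (env \<omega>) \<and> branch_mass \<gamma> j i (env \<omega>) \<le> K} \<ge> \<kappa>"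
    using branch_mass_bulk[OF assms(1,2)] .
  obtain r where r: "0 < r" "r < 1"
    "\<forall>i. prob {\<omega> \<in> space M. path_weight \<gamma> i (env \<omega>) < exp (- b * real (floor_log i))} \<le> r ^ floor_log i"
    using path_weight_lower[OF assms(1,3)] .
  define lo where "lo = (\<lambda>n. (1 - r ^ n) * (1 - exp (- (c0 * exp (c * real n) powr - p * \<kappa>) * 2 ^ n)))"
  have rate: "c0 * exp (c * real n) powr - p * \<kappa> * 2 ^ n = c0 * \<kappa> * exp (ln 2 - c * p) ^ n" for n
  proof -
    have "exp (c * real n) powr - p * 2 ^ n = exp (- (c * p) * real n) * exp (ln 2) ^ n"
      by (simp add: powr_def mult_ac)
    also have "\<dots> = exp (ln 2 - c * p) ^ n"
      unfolding exp_of_nat_mult[symmetric] exp_add[symmetric] by (simp add: algebra_simps)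
    finally show ?thesis by simp
  qed
  have "filterlim (\<lambda>n. exp (ln 2 - c * p) ^ n) at_top sequentially"
    by (intro filterlim_at_infinity_imp_filterlim_at_top filterlim_realpow_sequentially_gt1) (use p in auto)
  then have "filterlim (\<lambda>n. c0 * \<kappa> * exp (ln 2 - c * p) ^ n) at_top sequentially"
    using c0 K by (intro filterlim_tendsto_pos_mult_at_top[OF tendsto_const]) auto
  then have "filterlim (\<lambda>n. - (c0 * exp (c * real n) powr - p * \<kappa> * 2 ^ n)) at_bot sequentially"
    unfolding rate by (simp add: filterlim_uminus_at_bot)
  then have "(\<lambda>n. exp (- (c0 * exp (c * real n) powr - p * \<kappa> * 2 ^ n))) \<longlonglongrightarrow> 0"
    by (rule filterlim_compose[OF exp_at_bot])
  then have "lo \<longlonglongrightarrow> (1 - 0) * (1 - 0)"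
    unfolding lo_def using r by (intro tendsto_intros LIMSEQ_power_zero) auto
  then have "lo \<longlonglongrightarrow> 1" by simp
  moreover have "\<exists>J. \<forall>j\<ge>J. lo n \<le> prob {\<omega> \<in> space M. \<exists>v\<in>{2 ^ n..<2 ^ Suc n}.
      exp (- b * real n) \<le> path_weight \<gamma> v (env \<omega>) \<and> exp (c * real n) < branch_mass \<gamma> j (2 * v) (env \<omega>) \<and>
      1 / 8 < branch_mass \<gamma> j (Suc (2 * v)) (env \<omega>) \<and> branch_mass \<gamma> j (Suc (2 * v)) (env \<omega>) \<le> K}"
    if n: "n \<ge> 1" for n
  proof -
    let ?t = "exp (c * real n)"
    have "?t \<ge> 1" using assms(4) by simp
    then obtain J where J: "\<forall>j\<ge>J. \<forall>i\<ge>2. c0 * ?t powr - p \<le> prob {\<omega> \<in> space M. ?t < branch_mass \<gamma> j i (env \<omega>)}"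
      using c0(2) by blast
    show ?thesis
    proof (intro exI[of _ J] allI impI)
      fix j assume j: "j \<ge> J"
      show "lo n \<le> prob {\<omega> \<in> space M. \<exists>v\<in>{2 ^ n..<2 ^ Suc n}.
        exp (- b * real n) \<le> path_weight \<gamma> v (env \<omega>) \<and> ?t < branch_mass \<gamma> j (2 * v) (env \<omega>) \<and>
        1 / 8 < branch_mass \<gamma> j (Suc (2 * v)) (env \<omega>) \<and> branch_mass \<gamma> j (Suc (2 * v)) (env \<omega>) \<le> K}"
        unfolding lo_def
      proof (rule first_success_bound[OF n])
        show "0 \<le> c0 * ?t powr - p * \<kappa>" using c0 K by simp
        show "r ^ n \<le> 1" using r by (simp add: power_le_one)
        fix v assume v: "v \<in> {2 ^ n..<2 ^ Suc n :: nat}"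
        then have "v \<ge> 2" using n power_increasing[of 1 n "2::nat"] by auto
        then show "c0 * ?t powr - p * \<kappa> \<le> expectation (\<lambda>\<omega>. success ?t K j v (env \<omega>))"
          using c0(1) K by (intro success_probability J[rule_format, OF j] K(3)[rule_format]) auto
        have "floor_log v = n" using v by (intro floor_log_eqI) auto
        then show "prob {\<omega> \<in> space M. path_weight \<gamma> v (env \<omega>) < exp (- b * real n)} \<le> r ^ n"
          using r(3)[rule_format, of v] by simp
      qed
    qed
  qed
  ultimately show thesis using that[OF K(1)] by blast
qed

end

section \<open>Cell masses of the truncated cascade\<close>

lemma two_le_power_Suc_add: "2 \<le> 2 ^ Suc n + (k :: nat)"
proof -
  have "1 \<le> (2 :: nat) ^ n" by simp
  then show ?thesis unfolding power_Suc by linarith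
qed

text \<open>Heap index \<open>2 ^ n + k\<close> is the \<open>k\<close>-th dyadic interval of level \<open>n\<close>, counted from \<open>0\<close>.\<close>

definition heap_node :: "nat \<Rightarrow> nat \<times> real" where
  "heap_node i = (floor_log i, (real i - 2 ^ floor_log i) / 2 ^ floor_log i)"

lemma heap_node_eq:
  assumes "k < 2 ^ n" shows "heap_node (2 ^ n + k) = (n, real k / 2 ^ n)"
proof -
  have "floor_log (2 ^ n + k) = n" using assms by (intro floor_log_eqI) auto
  then show ?thesis by (simp add: heap_node_def)
qed

lemma heap_index_cases:
  fixes i :: nat
  assumes "i \<ge> 1"
  obtains n k where "i = 2 ^ n + k" "k < 2 ^ n"
proof (rule that[of "floor_log i" "i - 2 ^ floor_log i"])
  have "2 ^ floor_log i \<le> i" using assms by (intro floor_log_exp2_le) auto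
  then show "i = 2 ^ floor_log i + (i - 2 ^ floor_log i)" by simp
  show "i - 2 ^ floor_log i < 2 ^ floor_log i"
    using floor_log_exp2_gt[of i] \<open>2 ^ floor_log i \<le> i\<close> by simp
qed

lemma heap_node_mem:
  assumes "i \<ge> 2" shows "heap_node i \<in> dyadic_nodes"
proof -
  obtain n k where ik: "i = 2 ^ n + k" "k < 2 ^ n" using heap_index_cases[of i] assms by auto
  have "n \<ge> 1" using ik assms by (cases n) auto
  then show ?thesis unfolding ik(1) heap_node_eq[OF ik(2)] dyadic_nodes_def using ik(2) by blast
qed

lemma inj_on_heap_node: "inj_on heap_node {1..}"
proof (rule inj_onI)
  fix i j :: nat assume ij: "i \<in> {1..}" "j \<in> {1..}" "heap_node i = heap_node j"
  obtain n k where ik: "i = 2 ^ n + k" "k < 2 ^ n" using heap_index_cases[of i] ij by auto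
  obtain m l where jl: "j = 2 ^ m + l" "l < 2 ^ m" using heap_index_cases[of j] ij by auto
  have "(n, real k / 2 ^ n) = (m, real l / 2 ^ m)"
    using ij(3) unfolding ik(1) jl(1) heap_node_eq[OF ik(2)] heap_node_eq[OF jl(2)] .
  then have "n = m" "real k / 2 ^ n = real l / 2 ^ m" by blast+
  then show "i = j" using ik jl by simp
qed

definition node_env :: "(nat \<times> real \<Rightarrow> 'w \<Rightarrow> real) \<Rightarrow> 'w \<Rightarrow> nat \<Rightarrow> real" where
  "node_env X \<omega> = (\<lambda>i. X (heap_node i) \<omega>)"

lemma floor_dyadic_parent:
  fixes x :: real shows "\<lfloor>2 ^ n * x\<rfloor> = \<lfloor>2 ^ Suc n * x\<rfloor> div 2"
proof -
  have "\<lfloor>2 ^ n * x\<rfloor> = \<lfloor>2 ^ Suc n * x / real_of_int 2\<rfloor>" by simp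
  also have "\<dots> = \<lfloor>2 ^ Suc n * x\<rfloor> div 2" by (subst floor_divide_real_eq_div) auto
  finally show ?thesis .
qed

text \<open>On a dyadic interval of level \<open>N\<close> the density is constant; the power of two undoes the halvings contained in the
  weights.\<close>

lemma cascade_density_eq:
  assumes x: "x \<in> {0..<1}"
  shows "exp ((\<Sum>m=1..N. \<gamma> * X (m, dyadic_trunc m x) \<omega>) - \<gamma>\<^sup>2 / 2 * real N)
    = 2 ^ N * path_weight \<gamma> (2 ^ N + nat \<lfloor>2 ^ N * x\<rfloor>) (node_env X \<omega>)"
proof (induction N)
  case 0
  have "\<lfloor>x\<rfloor> = 0" using x by (simp add: floor_eq_iff)
  then show ?case by (simp add: path_weight_simps)
next
  case (Suc N)
  let ?k = "nat \<lfloor>2 ^ Suc N * x\<rfloor>"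
  let ?i = "2 ^ Suc N + ?k"
  have k: "?k < 2 ^ Suc N" by (rule dyadic_interval_of_eq(3)[OF x])
  have half: "?i div 2 = 2 ^ N + nat \<lfloor>2 ^ N * x\<rfloor>"
    unfolding floor_dyadic_parent[of N x] by (simp add: nat_div_distrib)
  have "?i \<ge> 2" by (rule two_le_power_Suc_add)
  then have W: "path_weight \<gamma> ?i (node_env X \<omega>)
      = path_weight \<gamma> (2 ^ N + nat \<lfloor>2 ^ N * x\<rfloor>) (node_env X \<omega>) * weight \<gamma> (node_env X \<omega> ?i)"
    by (simp only: path_weight_simps half)
  have "heap_node ?i = (Suc N, dyadic_trunc (Suc N) x)"
    unfolding heap_node_eq[OF k] dyadic_trunc_eq[OF x] using x by simp
  then have "2 * weight \<gamma> (node_env X \<omega> ?i) = exp (ln 2) * exp (\<gamma> * X (Suc N, dyadic_trunc (Suc N) x) \<omega> - (\<gamma>\<^sup>2 / 2 + ln 2))"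
    by (simp add: node_env_def weight_def)
  also have "\<dots> = exp (\<gamma> * X (Suc N, dyadic_trunc (Suc N) x) \<omega> - \<gamma>\<^sup>2 / 2)"
    by (simp only: exp_add[symmetric]) simp
  finally have w: "exp (\<gamma> * X (Suc N, dyadic_trunc (Suc N) x) \<omega> - \<gamma>\<^sup>2 / 2) = 2 * weight \<gamma> (node_env X \<omega> ?i)" ..
  have "exp ((\<Sum>m=1..Suc N. \<gamma> * X (m, dyadic_trunc m x) \<omega>) - \<gamma>\<^sup>2 / 2 * real (Suc N))
      = exp ((\<Sum>m=1..N. \<gamma> * X (m, dyadic_trunc m x) \<omega>) - \<gamma>\<^sup>2 / 2 * real N)
        * exp (\<gamma> * X (Suc N, dyadic_trunc (Suc N) x) \<omega> - \<gamma>\<^sup>2 / 2)"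
    by (simp add: exp_add[symmetric] algebra_simps)
  also have "\<dots> = 2 ^ Suc N * path_weight \<gamma> ?i (node_env X \<omega>)"
    unfolding Suc.IH w W by (simp add: mult_ac)
  finally show ?case .
qed

text \<open>The density of the truncated cascade as a function of an integer-valued floor, which makes measurability evident although the
  random variables are attached to real left endpoints.\<close>

definition step_density :: "real \<Rightarrow> (nat \<Rightarrow> real) \<Rightarrow> nat \<Rightarrow> real \<Rightarrow> ennreal" where
  "step_density \<gamma> z N x = indicator {0..<1} x * ennreal (2 ^ N * path_weight \<gamma> (2 ^ N + nat \<lfloor>2 ^ N * x\<rfloor>) z)"

lemma step_density_measurable [measurable]: "step_density \<gamma> z N \<in> borel_measurable borel"
proof -
  have "(\<lambda>x::real. (\<lambda>i. ennreal (2 ^ N * path_weight \<gamma> (2 ^ N + nat i) z)) \<lfloor>2 ^ N * x\<rfloor>) \<in> borel_measurable borel"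
    by (rule measurable_compose[of _ _ "count_space UNIV"]) measurable
  then show ?thesis unfolding step_density_def[abs_def] by measurable
qed

lemma cascade_approx_eq: "cascade_approx \<gamma> X N \<omega> = density lborel (step_density \<gamma> (node_env X \<omega>) N)"
  unfolding cascade_approx_def
proof (rule arg_cong[where f = "density lborel"], rule ext)
  fix x :: real
  show "indicator {0..<1} x * ennreal (exp ((\<Sum>m=1..N. \<gamma> * X (m, dyadic_trunc m x) \<omega>) - \<gamma>\<^sup>2 / 2 * real N))
      = step_density \<gamma> (node_env X \<omega>) N x"
  proof (cases "x \<in> {0..<1}")
    case True
    then show ?thesis by (simp only: step_density_def cascade_density_eq)
  next
    case False
    then have "indicator {0..<1} x = (0 :: ennreal)" by (rule indicator_simps)
    then show ?thesis by (simp only: step_density_def mult_zero_left)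
  qed
qed

lemma sets_cascade_approx [simp]: "sets (cascade_approx \<gamma> X N \<omega>) = sets borel"
  by (simp add: cascade_approx_def)

lemma dyadic_interval_borel [measurable]: "dyadic_interval n k \<in> sets borel"
  by (simp add: dyadic_interval_def)

lemma dyadic_interval_subset: "k < 2 ^ n \<Longrightarrow> dyadic_interval n k \<subseteq> {0..<1}"
proof
  fix x assume k: "k < 2 ^ n" and x: "x \<in> dyadic_interval n k"
  have "real k + 1 \<le> 2 ^ n" using k by (metis Suc_leI of_nat_Suc of_nat_le_iff of_nat_numeral of_nat_power add.commute)
  then have "(real k + 1) / 2 ^ n \<le> 1" by simp
  moreover have "0 \<le> real k / 2 ^ n" by simp
  ultimately show "x \<in> {0..<1}" using x unfolding dyadic_interval_def atLeastLessThan_iff by linarith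
qed

lemma dyadic_interval_split:
  "dyadic_interval n k = dyadic_interval (Suc n) (2 * k) \<union> dyadic_interval (Suc n) (Suc (2 * k))"
  "dyadic_interval (Suc n) (2 * k) \<inter> dyadic_interval (Suc n) (Suc (2 * k)) = {}"
proof -
  have "x \<in> dyadic_interval n k \<longleftrightarrow> x \<in> dyadic_interval (Suc n) (2 * k) \<or> x \<in> dyadic_interval (Suc n) (Suc (2 * k))" for x
    unfolding mem_dyadic_interval_iff floor_dyadic_parent[of n] by presburger
  then show "dyadic_interval n k = dyadic_interval (Suc n) (2 * k) \<union> dyadic_interval (Suc n) (Suc (2 * k))"
    by blast
  show "dyadic_interval (Suc n) (2 * k) \<inter> dyadic_interval (Suc n) (Suc (2 * k)) = {}"
    by (auto simp: mem_dyadic_interval_iff simp del: power_Suc)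
qed

lemma emeasure_cascade_approx_level:
  assumes k: "k < 2 ^ N"
  shows "emeasure (cascade_approx \<gamma> X N \<omega>) (dyadic_interval N k) = ennreal (path_weight \<gamma> (2 ^ N + k) (node_env X \<omega>))"
proof -
  let ?W = "path_weight \<gamma> (2 ^ N + k) (node_env X \<omega>)"
  have "emeasure (cascade_approx \<gamma> X N \<omega>) (dyadic_interval N k)
      = (\<integral>\<^sup>+x. step_density \<gamma> (node_env X \<omega>) N x * indicator (dyadic_interval N k) x \<partial>lborel)"
    unfolding cascade_approx_eq by (rule emeasure_density) auto
  also have "\<dots> = (\<integral>\<^sup>+x. ennreal (2 ^ N * ?W) * indicator (dyadic_interval N k) x \<partial>lborel)"
  proof (rule nn_integral_cong)
    fix x :: real
    show "step_density \<gamma> (node_env X \<omega>) N x * indicator (dyadic_interval N k) x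
        = ennreal (2 ^ N * ?W) * indicator (dyadic_interval N k) x"
    proof (cases "x \<in> dyadic_interval N k")
      case True
      then have "x \<in> {0..<1}" using dyadic_interval_subset[OF k] by blast
      moreover have "nat \<lfloor>2 ^ N * x\<rfloor> = k" using True unfolding mem_dyadic_interval_iff by simp
      ultimately show ?thesis by (simp add: step_density_def)
    qed simp
  qed
  also have "\<dots> = ennreal (2 ^ N * ?W) * emeasure lborel (dyadic_interval N k)"
    by (rule nn_integral_cmult_indicator) simp
  also have "emeasure lborel (dyadic_interval N k) = ennreal (1 / 2 ^ N)"
    by (simp add: dyadic_interval_def divide_right_mono add_divide_distrib)
  also have "ennreal (2 ^ N * ?W) * ennreal (1 / 2 ^ N) = ennreal ?W"
    by (simp add: ennreal_mult[symmetric] less_imp_le[OF path_weight_pos])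
  finally show ?thesis .
qed

lemma emeasure_cascade_approx:
  assumes "k < 2 ^ Suc n"
  shows "emeasure (cascade_approx \<gamma> X (Suc n + j) \<omega>) (dyadic_interval (Suc n) k)
    = ennreal (path_weight \<gamma> ((2 ^ Suc n + k) div 2) (node_env X \<omega>) * branch_mass \<gamma> j (2 ^ Suc n + k) (node_env X \<omega>))"
  using assms
proof (induction j arbitrary: n k)
  case 0
  have "2 ^ Suc n + k \<ge> 2" by (rule two_le_power_Suc_add)
  then show ?case
    using emeasure_cascade_approx_level[OF 0, of \<gamma> X \<omega>] by (simp only: path_weight_simps add_0_right branch_mass.simps)
next
  case (Suc j)
  let ?i = "2 ^ Suc n + k" and ?z = "node_env X \<omega>"
  let ?\<mu> = "cascade_approx \<gamma> X (Suc n + Suc j) \<omega>"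
  have i: "?i \<ge> 2" by (rule two_le_power_Suc_add)
  have N: "Suc n + Suc j = Suc (Suc n) + j" by simp
  have child: "2 ^ Suc (Suc n) + 2 * k = 2 * ?i" "2 ^ Suc (Suc n) + Suc (2 * k) = Suc (2 * ?i)" by simp_all
  have div: "2 * m div 2 = m" "Suc (2 * m) div 2 = m" for m :: nat by simp_all
  have IH: "emeasure ?\<mu> (dyadic_interval (Suc (Suc n)) (2 * k)) = ennreal (path_weight \<gamma> ?i ?z * branch_mass \<gamma> j (2 * ?i) ?z)"
    "emeasure ?\<mu> (dyadic_interval (Suc (Suc n)) (Suc (2 * k))) = ennreal (path_weight \<gamma> ?i ?z * branch_mass \<gamma> j (Suc (2 * ?i)) ?z)"
    using Suc.IH[of "2 * k" "Suc n"] Suc.IH[of "Suc (2 * k)" "Suc n"] Suc.prems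
    unfolding N child div by simp_all
  have "emeasure ?\<mu> (dyadic_interval (Suc n) k)
      = emeasure ?\<mu> (dyadic_interval (Suc (Suc n)) (2 * k)) + emeasure ?\<mu> (dyadic_interval (Suc (Suc n)) (Suc (2 * k)))"
    unfolding dyadic_interval_split(1)[of "Suc n" k]
    by (rule plus_emeasure[symmetric]) (simp_all add: dyadic_interval_split(2))
  also have "\<dots> = ennreal (path_weight \<gamma> ?i ?z * (branch_mass \<gamma> j (2 * ?i) ?z + branch_mass \<gamma> j (Suc (2 * ?i)) ?z))"
    unfolding IH by (subst ennreal_plus[symmetric])
      (simp_all only: distrib_left mult_nonneg_nonneg less_imp_le[OF path_weight_pos] less_imp_le[OF branch_mass_pos])
  also have "path_weight \<gamma> ?i ?z * (branch_mass \<gamma> j (2 * ?i) ?z + branch_mass \<gamma> j (Suc (2 * ?i)) ?z)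
      = path_weight \<gamma> (?i div 2) ?z * branch_mass \<gamma> (Suc j) ?i ?z"
    unfolding path_weight_simps(2)[OF i] branch_mass.simps by (simp only: mult.assoc)
  finally show ?case .
qed

lemma emeasure_cascade_approx_outside:
  assumes "B \<in> sets borel"
  shows "emeasure (cascade_approx \<gamma> X N \<omega>) B = emeasure (cascade_approx \<gamma> X N \<omega>) (B \<inter> {0..<1})"
proof -
  have "(\<integral>\<^sup>+x. step_density \<gamma> (node_env X \<omega>) N x * indicator B x \<partial>lborel)
      = (\<integral>\<^sup>+x. step_density \<gamma> (node_env X \<omega>) N x * indicator (B \<inter> {0..<1}) x \<partial>lborel)"
    by (intro nn_integral_cong) (auto simp: step_density_def indicator_def)
  then show ?thesis using assms by (simp add: cascade_approx_eq emeasure_density)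
qed

lemma finite_measure_cascade_approx: "finite_measure (cascade_approx \<gamma> X (Suc N) \<omega>)"
proof (rule finite_measureI)
  let ?\<mu> = "cascade_approx \<gamma> X (Suc N) \<omega>"
  have "{0..<1} = dyadic_interval 0 0" by (simp add: dyadic_interval_def)
  also have "\<dots> = dyadic_interval (Suc 0) 0 \<union> dyadic_interval (Suc 0) 1"
    using dyadic_interval_split(1)[of 0 0] by simp
  finally have "emeasure ?\<mu> {0..<1} \<le> emeasure ?\<mu> (dyadic_interval (Suc 0) 0) + emeasure ?\<mu> (dyadic_interval (Suc 0) 1)"
    by (simp add: emeasure_subadditive)
  also have "\<dots> < \<infinity>"
    using emeasure_cascade_approx[of 0 0 \<gamma> X N \<omega>] emeasure_cascade_approx[of 1 0 \<gamma> X N \<omega>] by simp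
  finally have "emeasure ?\<mu> {0..<1} < \<infinity>" .
  moreover have "space ?\<mu> = UNIV" by (simp add: cascade_approx_def)
  ultimately show "emeasure ?\<mu> (space ?\<mu>) \<noteq> \<infinity>"
    using emeasure_cascade_approx_outside[of UNIV \<gamma> X "Suc N" \<omega>] by simp
qed

section \<open>Weak convergence on intervals\<close>

text \<open>One half of the portmanteau theorem, for a half-open interval without mass at its endpoints: the indicator is
  enclosed between continuous functions rising linearly with slope \<open>m\<close>.\<close>

lemma weakly_converges_ivl:
  fixes l r :: real
  assumes weak: "weakly_converges \<nu> \<mu>"
    and sets: "\<And>n. sets (\<nu> n) = sets borel" "sets \<mu> = sets borel"
    and finite: "\<And>n. n \<ge> 1 \<Longrightarrow> finite_measure (\<nu> n)" "finite_measure \<mu>"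
    and ends: "measure \<mu> {l} = 0" "measure \<mu> {r} = 0"
  shows "(\<lambda>n. measure (\<nu> n) {l..<r}) \<longlonglongrightarrow> measure \<mu> {l..<r}"
proof -
  interpret \<mu>: finite_measure \<mu> by (rule finite)
  note [measurable_cong] = sets
  define f where "f = (\<lambda>(m::nat) x. max 0 (min 1 (real m * min (x - l) (r - x))))"
  define g where "g = (\<lambda>(m::nat) x. max 0 (min 1 (1 + real m * min (x - l) (r - x))))"
  have f_bounds: "0 \<le> f m x" "f m x \<le> indicator {l..<r} x" for m x
  proof -
    have "real m * min (x - l) (r - x) \<le> 0" if "x \<notin> {l..<r}"
      using that by (intro mult_nonneg_nonpos) auto
    then show "0 \<le> f m x" "f m x \<le> indicator {l..<r} x"
      by (auto simp: f_def indicator_def)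
  qed
  have g_bounds: "indicator {l..<r} x \<le> g m x" "g m x \<le> 1" for m x
  proof -
    have "0 \<le> real m * min (x - l) (r - x)" if "x \<in> {l..<r}"
      using that by (intro mult_nonneg_nonneg) auto
    then show "indicator {l..<r} x \<le> g m x" "g m x \<le> 1"
      by (auto simp: g_def indicator_def)
  qed
  have f_le1: "f m x \<le> 1" for m x by (simp add: f_def)
  have g_ge0: "0 \<le> g m x" for m x by (simp add: g_def)
  have cont: "continuous_on UNIV (f m)" "continuous_on UNIV (g m)" for m
    unfolding f_def g_def by (auto intro!: continuous_intros)
  then have [measurable]: "f m \<in> borel_measurable borel" "g m \<in> borel_measurable borel" for m
    by (auto intro: borel_measurable_continuous_onI)
  have bdd: "bounded (range (f m))" "bounded (range (g m))" for m
    by (rule boundedI[of _ 1]; use f_bounds f_le1 g_ge0 g_bounds in auto)+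
  have conv: "(\<lambda>n. \<integral>x. f m x \<partial>\<nu> n) \<longlonglongrightarrow> (\<integral>x. f m x \<partial>\<mu>)" "(\<lambda>n. \<integral>x. g m x \<partial>\<nu> n) \<longlonglongrightarrow> (\<integral>x. g m x \<partial>\<mu>)" for m
    using weak cont bdd unfolding weakly_converges_def by blast+
  have f_lim: "(\<lambda>m. f m x) \<longlonglongrightarrow> indicator {l<..<r} x" for x
  proof (cases "x \<in> {l<..<r}")
    case True
    then have pos: "min (x - l) (r - x) > 0" by auto
    obtain k :: nat where k: "1 < real k * min (x - l) (r - x)" using reals_Archimedean3[OF pos] by blast
    have "f m x = 1" if "m \<ge> k" for m
    proof -
      have "real k * min (x - l) (r - x) \<le> real m * min (x - l) (r - x)"
        using that pos by (intro mult_right_mono) auto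
      then show ?thesis using k unfolding f_def by linarith
    qed
    then have "\<forall>\<^sub>F m in sequentially. f m x = 1" using eventually_sequentially by blast
    then show ?thesis using True by (simp add: tendsto_eventually)
  next
    case False
    then have "real m * min (x - l) (r - x) \<le> 0" for m
      by (intro mult_nonneg_nonpos) auto
    then show ?thesis using False by (simp add: f_def max_absorb1 min.coboundedI2)
  qed
  have g_lim: "(\<lambda>m. g m x) \<longlonglongrightarrow> indicator {l..r} x" for x
  proof (cases "x \<in> {l..r}")
    case True
    then have "0 \<le> real m * min (x - l) (r - x)" for m
      by (intro mult_nonneg_nonneg) auto
    then show ?thesis using True by (simp add: g_def min_absorb1)
  next
    case False
    then have pos: "- min (x - l) (r - x) > 0" by auto
    obtain k :: nat where k: "1 < real k * - min (x - l) (r - x)" using reals_Archimedean3[OF pos] by blast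
    have "g m x = 0" if "m \<ge> k" for m
    proof -
      have "real k * - min (x - l) (r - x) \<le> real m * - min (x - l) (r - x)"
        using that pos by (intro mult_right_mono) auto
      then show ?thesis using k unfolding g_def by linarith
    qed
    then have "\<forall>\<^sub>F m in sequentially. g m x = 0" using eventually_sequentially by blast
    then show ?thesis using False by (simp add: tendsto_eventually)
  qed
  have "(\<lambda>m. \<integral>x. f m x \<partial>\<mu>) \<longlonglongrightarrow> (\<integral>x. indicator {l<..<r} x \<partial>\<mu>)"
    by (rule integral_dominated_convergence[where w = "\<lambda>_. 1"]) (use f_bounds f_le1 f_lim in auto)
  then have f_int: "(\<lambda>m. \<integral>x. f m x \<partial>\<mu>) \<longlonglongrightarrow> measure \<mu> {l<..<r}" by (simp add: sets)
  have "(\<lambda>m. \<integral>x. g m x \<partial>\<mu>) \<longlonglongrightarrow> (\<integral>x. indicator {l..r} x \<partial>\<mu>)"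
    by (rule integral_dominated_convergence[where w = "\<lambda>_. 1"]) (use g_bounds g_ge0 g_lim in auto)
  then have g_int: "(\<lambda>m. \<integral>x. g m x \<partial>\<mu>) \<longlonglongrightarrow> measure \<mu> {l..r}" by (simp add: sets)
  have "measure \<mu> {l..r} \<le> measure \<mu> ({l<..<r} \<union> ({l} \<union> {r}))"
    by (intro \<mu>.finite_measure_mono) (auto simp: sets)
  also have "\<dots> \<le> measure \<mu> {l<..<r} + measure \<mu> ({l} \<union> {r})"
    by (rule measure_Un_le) (auto simp: sets)
  also have "measure \<mu> ({l} \<union> {r}) \<le> measure \<mu> {l} + measure \<mu> {r}"
    by (rule measure_Un_le) (auto simp: sets)
  finally have outer: "measure \<mu> {l..r} \<le> measure \<mu> {l<..<r}" using ends by simp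
  have inner: "measure \<mu> {l<..<r} \<le> measure \<mu> {l..<r}" "measure \<mu> {l..<r} \<le> measure \<mu> {l..r}"
    by (intro \<mu>.finite_measure_mono; auto simp: sets)+
  have f_le: "(\<integral>x. f m x \<partial>\<nu> n) \<le> measure (\<nu> n) {l..<r}" and g_ge: "measure (\<nu> n) {l..<r} \<le> (\<integral>x. g m x \<partial>\<nu> n)"
    if n: "n \<ge> 1" for m n
  proof -
    interpret \<nu>: finite_measure "\<nu> n" by (rule finite(1)[OF n])
    have i: "integrable (\<nu> n) (f m)" "integrable (\<nu> n) (g m)"
      by (rule \<nu>.integrable_const_bound[where B = 1]; use f_bounds f_le1 g_ge0 g_bounds in auto)+
    have ind: "integrable (\<nu> n) (indicator {l..<r} :: real \<Rightarrow> real)"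
      by (rule integrable_real_indicator) (auto simp: sets \<nu>.emeasure_eq_measure)
    show "(\<integral>x. f m x \<partial>\<nu> n) \<le> measure (\<nu> n) {l..<r}"
      using integral_mono[OF i(1) ind f_bounds(2)] by (simp add: sets)
    show "measure (\<nu> n) {l..<r} \<le> (\<integral>x. g m x \<partial>\<nu> n)"
      using integral_mono[OF ind i(2) g_bounds(1)] by (simp add: sets)
  qed
  show ?thesis
  proof (rule order_tendstoI)
    fix a assume "a < measure \<mu> {l..<r}"
    then have "\<forall>\<^sub>F m in sequentially. a < (\<integral>x. f m x \<partial>\<mu>)"
      using outer inner by (intro order_tendstoD(1)[OF f_int]) auto
    then obtain m where "a < (\<integral>x. f m x \<partial>\<mu>)" by (auto simp: eventually_sequentially)
    then have "\<forall>\<^sub>F n in sequentially. a < (\<integral>x. f m x \<partial>\<nu> n)"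
      by (rule order_tendstoD(1)[OF conv(1)])
    then show "\<forall>\<^sub>F n in sequentially. a < measure (\<nu> n) {l..<r}"
      using eventually_ge_at_top[of 1] by eventually_elim (use f_le in \<open>auto intro: less_le_trans\<close>)
  next
    fix a assume "measure \<mu> {l..<r} < a"
    then have "\<forall>\<^sub>F m in sequentially. (\<integral>x. g m x \<partial>\<mu>) < a"
      using outer inner by (intro order_tendstoD(2)[OF g_int]) auto
    then obtain m where "(\<integral>x. g m x \<partial>\<mu>) < a" by (auto simp: eventually_sequentially)
    then have "\<forall>\<^sub>F n in sequentially. (\<integral>x. g m x \<partial>\<nu> n) < a"
      by (rule order_tendstoD(2)[OF conv(2)])
    then show "\<forall>\<^sub>F n in sequentially. measure (\<nu> n) {l..<r} < a"
      using eventually_ge_at_top[of 1] by eventually_elim (use g_ge in \<open>auto intro: le_less_trans\<close>)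
  qed
qed

text \<open>The tent of radius \<open>2 ^ - Suc n\<close> around a dyadic point of level \<open>Suc n\<close> lives on the at most two cells of this level
  that touch the point; at the ends of the unit interval there is only one.\<close>

lemma tent_le_cells:
  fixes X :: "nat \<times> real \<Rightarrow> 'w \<Rightarrow> real"
  assumes K: "K \<le> 2 ^ Suc n"
  shows "(\<integral>y. max 0 (1 - 2 ^ Suc n * \<bar>y - real K / 2 ^ Suc n\<bar>) \<partial>cascade_approx \<gamma> X (Suc n + j) \<omega>)
    \<le> (\<Sum>k\<in>{k. k < 2 ^ Suc n \<and> (k = K \<or> Suc k = K)}.
        measure (cascade_approx \<gamma> X (Suc n + j) \<omega>) (dyadic_interval (Suc n) k))"
proof -
  let ?m = "Suc n" and ?\<mu> = "cascade_approx \<gamma> X (Suc n + j) \<omega>"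
  let ?S = "{k. k < 2 ^ Suc n \<and> (k = K \<or> Suc k = K)}"
  let ?B = "{y. \<bar>2 ^ ?m * y - real K\<bar> < 1}"
  interpret finite_measure ?\<mu> using finite_measure_cascade_approx[of \<gamma> X "n + j" \<omega>] by simp
  note [measurable_cong] = sets_cascade_approx
  have S: "finite ?S" by simp
  have B: "?B \<in> sets borel" by measurable
  have cover: "?B \<inter> {0..<1} \<subseteq> (\<Union>k\<in>?S. dyadic_interval ?m k)"
  proof
    fix y assume y: "y \<in> ?B \<inter> {0..<1}"
    define k where "k = nat \<lfloor>2 ^ ?m * y\<rfloor>"
    have k: "k < 2 ^ ?m" unfolding k_def using y by (intro dyadic_interval_of_eq(3)) auto
    have k_eq: "int k = \<lfloor>2 ^ ?m * y\<rfloor>" unfolding k_def using y by simp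
    then have yk: "y \<in> dyadic_interval ?m k" unfolding mem_dyadic_interval_iff by simp
    have "real k \<le> 2 ^ ?m * y" "2 ^ ?m * y < real k + 1"
      using k_eq by linarith+
    moreover have "2 ^ ?m * y < real K + 1" "real K < 2 ^ ?m * y + 1"
      using y by (auto simp only: Int_iff mem_Collect_eq abs_less_iff)
    ultimately have "k = K \<or> Suc k = K" by linarith
    then show "y \<in> (\<Union>k\<in>?S. dyadic_interval ?m k)" using k yk by blast
  qed
  have le: "max 0 (1 - 2 ^ ?m * \<bar>y - real K / 2 ^ ?m\<bar>) \<le> indicator ?B y" for y :: real
  proof -
    have "2 ^ ?m * \<bar>y - real K / 2 ^ ?m\<bar> = \<bar>2 ^ ?m * (y - real K / 2 ^ ?m)\<bar>"
      by (simp add: abs_mult)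
    also have "2 ^ ?m * (y - real K / 2 ^ ?m) = 2 ^ ?m * y - real K"
      by (simp add: right_diff_distrib)
    finally have "2 ^ ?m * \<bar>y - real K / 2 ^ ?m\<bar> = \<bar>2 ^ ?m * y - real K\<bar>" .
    then show ?thesis by (simp only:) (auto simp: indicator_def simp del: power_Suc)
  qed
  have "(\<integral>y. max 0 (1 - 2 ^ ?m * \<bar>y - real K / 2 ^ ?m\<bar>) \<partial>?\<mu>) \<le> (\<integral>y. indicator ?B y \<partial>?\<mu>)"
  proof (rule integral_mono[OF _ _ le])
    show "integrable ?\<mu> (\<lambda>y. max 0 (1 - 2 ^ ?m * \<bar>y - real K / 2 ^ ?m\<bar>))"
      by (rule integrable_const_bound[where B = 1]) (auto simp del: power_Suc)
    show "integrable ?\<mu> (indicator ?B :: real \<Rightarrow> real)"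
      by (rule integrable_real_indicator)
        (simp_all only: sets_cascade_approx B emeasure_eq_measure ennreal_less_top infinity_ennreal_def)
  qed
  also have "\<dots> = measure ?\<mu> ?B" using B by (simp del: power_Suc)
  also have "\<dots> = measure ?\<mu> (?B \<inter> {0..<1})"
    unfolding measure_def emeasure_cascade_approx_outside[OF B] ..
  also have "\<dots> \<le> measure ?\<mu> (\<Union>k\<in>?S. dyadic_interval ?m k)"
    by (rule finite_measure_mono[OF cover]) auto
  also have "\<dots> \<le> (\<Sum>k\<in>?S. measure ?\<mu> (dyadic_interval ?m k))"
    by (rule measure_UNION_le[OF S]) simp
  finally show ?thesis .
qed

section \<open>Cell masses of the limit measure\<close>

lemma (in iid_normal_tree) cell_mass_mean:
  assumes "i \<ge> 2"
  shows "integrable M (\<lambda>\<omega>. path_weight \<gamma> (i div 2) (env \<omega>) * branch_mass \<gamma> j i (env \<omega>))"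
    and "expectation (\<lambda>\<omega>. path_weight \<gamma> (i div 2) (env \<omega>) * branch_mass \<gamma> j i (env \<omega>)) = (1 / 2) ^ floor_log i"
proof -
  have W: "integrable M (\<lambda>\<omega>. path_weight \<gamma> (i div 2) (env \<omega>))"
    "expectation (\<lambda>\<omega>. path_weight \<gamma> (i div 2) (env \<omega>)) = (1 / 2) ^ floor_log (i div 2)"
    using path_weight_moment[of "i div 2" 1] by (simp_all add: weight_moment_1 abs_of_pos)
  note V = branch_mass_mean[OF assms, of j]
  have ind: "indep_var borel (\<lambda>\<omega>. path_weight \<gamma> (i div 2) (env \<omega>)) borel (\<lambda>\<omega>. branch_mass \<gamma> j i (env \<omega>))"
  proof (rule indep_var_blocks[OF _ _ _ depends_on_path_weight depends_on_branch_mass])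
    show "{2..i div 2} \<inter> subtree i = {}" using subtree_ge[of i] assms by fastforce
    show "subtree i \<subseteq> {2..}" using subtree_ge[of i] assms by auto
  qed auto
  show "integrable M (\<lambda>\<omega>. path_weight \<gamma> (i div 2) (env \<omega>) * branch_mass \<gamma> j i (env \<omega>))"
    by (rule indep_var_integrable[OF ind W(1) V[THEN conjunct1]])
  show "expectation (\<lambda>\<omega>. path_weight \<gamma> (i div 2) (env \<omega>) * branch_mass \<gamma> j i (env \<omega>)) = (1 / 2) ^ floor_log i"
    unfolding indep_var_lebesgue_integral[OF ind W(1) V[THEN conjunct1]] W(2) V[THEN conjunct2]
    using assms by (simp add: floor_log_rec del: floor_log_half)
qed

locale dyadic_cascade = prob_space M for M :: "'w measure" +
  fixes X :: "nat \<times> real \<Rightarrow> 'w \<Rightarrow> real" and \<mu> :: "'w \<Rightarrow> real measure" and \<gamma> :: real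
  assumes indep_nodes: "indep_vars (\<lambda>_. borel) X dyadic_nodes"
    and normal_nodes: "\<And>v. v \<in> dyadic_nodes \<Longrightarrow> distributed M lborel (X v) std_normal_density"
    and cascade: "cascade_measure M \<gamma> X \<mu>"

sublocale dyadic_cascade \<subseteq> iid_normal_tree M \<gamma> "\<lambda>i. X (heap_node i)"
proof unfold_locales
  fix i :: nat assume "i \<ge> 2"
  then show "distributed M lborel (X (heap_node i)) std_normal_density"
    by (intro normal_nodes heap_node_mem)
next
  have "indep_vars (\<lambda>i. PiM {heap_node i} (\<lambda>_. borel)) (\<lambda>i \<omega>. restrict (\<lambda>v. X v \<omega>) {heap_node i}) {2..}"
  proof (rule indep_vars_restrict[OF indep_nodes])
    show "\<And>i. i \<in> {2..} \<Longrightarrow> {heap_node i} \<subseteq> dyadic_nodes" using heap_node_mem by auto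
    show "disjoint_family_on (\<lambda>i. {heap_node i}) {2..}"
      unfolding disjoint_family_on_def using inj_on_heap_node by (auto dest: inj_onD)
  qed
  then have "indep_vars (\<lambda>_. borel) (\<lambda>i \<omega>. (restrict (\<lambda>v. X v \<omega>) {heap_node i}) (heap_node i)) {2..}"
    by (rule indep_vars_compose2) (simp add: measurable_component_singleton)
  then show "indep_vars (\<lambda>_. borel) (\<lambda>i. X (heap_node i)) {2..}" by simp
qed

context dyadic_cascade
begin

lemma node_env_eq: "node_env X \<omega> = env \<omega>"
  by (simp add: node_env_def env_def)

lemma cascade_facts:
  "\<omega> \<in> space M \<Longrightarrow> sets (\<mu> \<omega>) = sets borel"
  "\<omega> \<in> space M \<Longrightarrow> finite_measure (\<mu> \<omega>)"
  "A \<in> sets borel \<Longrightarrow> (\<lambda>\<omega>. emeasure (\<mu> \<omega>) A) \<in> borel_measurable M"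
  "AE \<omega> in M. weakly_converges (\<lambda>n. cascade_approx \<gamma> X n \<omega>) (\<mu> \<omega>)"
  using cascade unfolding cascade_measure_def random_measure_on_def by auto

lemma measure_cascade_approx:
  assumes "k < 2 ^ Suc n"
  shows "measure (cascade_approx \<gamma> X (Suc n + j) \<omega>) (dyadic_interval (Suc n) k)
    = path_weight \<gamma> ((2 ^ Suc n + k) div 2) (env \<omega>) * branch_mass \<gamma> j (2 ^ Suc n + k) (env \<omega>)"
  unfolding measure_def emeasure_cascade_approx[OF assms] node_env_eq
  by (simp add: less_imp_le[OF path_weight_pos] less_imp_le[OF branch_mass_pos] del: power_Suc)

lemma nn_integral_cells:
  assumes "finite S" "S \<subseteq> {..<2 ^ Suc n}"
  shows "(\<integral>\<^sup>+\<omega>. ennreal (\<Sum>k\<in>S. measure (cascade_approx \<gamma> X (Suc n + j) \<omega>) (dyadic_interval (Suc n) k)) \<partial>M)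
    = ennreal (real (card S) * (1 / 2) ^ Suc n)"
proof -
  let ?f = "\<lambda>k \<omega>. path_weight \<gamma> ((2 ^ Suc n + k) div 2) (env \<omega>) * branch_mass \<gamma> j (2 ^ Suc n + k) (env \<omega>)"
  have pos: "0 \<le> ?f k \<omega>" for k \<omega>
    by (intro mult_nonneg_nonneg less_imp_le[OF path_weight_pos] less_imp_le[OF branch_mass_pos])
  have "(\<integral>\<^sup>+\<omega>. ennreal (\<Sum>k\<in>S. measure (cascade_approx \<gamma> X (Suc n + j) \<omega>) (dyadic_interval (Suc n) k)) \<partial>M)
      = (\<integral>\<^sup>+\<omega>. ennreal (\<Sum>k\<in>S. ?f k \<omega>) \<partial>M)"
    using assms by (intro nn_integral_cong arg_cong[where f = ennreal] sum.cong refl measure_cascade_approx) auto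
  also have "\<dots> = ennreal (expectation (\<lambda>\<omega>. \<Sum>k\<in>S. ?f k \<omega>))"
    by (rule nn_integral_eq_integral)
      (use pos two_le_power_Suc_add in \<open>auto intro!: Bochner_Integration.integrable_sum cell_mass_mean(1) sum_nonneg simp del: power_Suc\<close>)
  also have "expectation (\<lambda>\<omega>. \<Sum>k\<in>S. ?f k \<omega>) = (\<Sum>k\<in>S. expectation (?f k))"
    by (rule Bochner_Integration.integral_sum) (rule cell_mass_mean(1)[OF two_le_power_Suc_add])
  also have "\<dots> = (\<Sum>k\<in>S. (1 / 2) ^ Suc n)"
  proof (rule sum.cong[OF refl])
    fix k assume "k \<in> S"
    then have "floor_log (2 ^ Suc n + k) = Suc n" using assms by (intro floor_log_eqI) auto
    then show "expectation (?f k) = (1 / 2) ^ Suc n"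
      using cell_mass_mean(2)[OF two_le_power_Suc_add] by metis
  qed
  finally show ?thesis by simp
qed

text \<open>An atom is bounded by the integral of a tent, this integral is the limit of those for the truncated cascades,
  and Fatou's lemma passes the mean masses of the two adjacent cells to the limit.\<close>

lemma no_dyadic_atom_bound:
  assumes K: "K \<le> 2 ^ Suc n"
  shows "(\<integral>\<^sup>+\<omega>. emeasure (\<mu> \<omega>) {real K / 2 ^ Suc n} \<partial>M) \<le> ennreal (2 * (1 / 2) ^ Suc n)"
proof -
  let ?x = "real K / 2 ^ Suc n"
  let ?S = "{k. k < 2 ^ Suc n \<and> (k = K \<or> Suc k = K)}"
  define h where "h = (\<lambda>y. max 0 (1 - 2 ^ Suc n * \<bar>y - ?x\<bar>))"
  define Q where "Q = (\<lambda>j \<omega>. \<Sum>k\<in>?S. measure (cascade_approx \<gamma> X (Suc n + j) \<omega>) (dyadic_interval (Suc n) k))"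
  have h_cont: "continuous_on UNIV h" unfolding h_def by (intro continuous_intros)
  then have [measurable]: "h \<in> borel_measurable borel" by (rule borel_measurable_continuous_onI)
  have h01: "0 \<le> h y" "h y \<le> 1" for y by (simp_all add: h_def)
  have Q_eq: "Q j \<omega> = (\<Sum>k\<in>?S. path_weight \<gamma> ((2 ^ Suc n + k) div 2) (env \<omega>) * branch_mass \<gamma> j (2 ^ Suc n + k) (env \<omega>))" for j \<omega>
    unfolding Q_def by (intro sum.cong refl measure_cascade_approx) auto
  have [measurable]: "Q j \<in> borel_measurable M" for j
    unfolding Q_eq[abs_def]
    by (intro borel_measurable_sum borel_measurable_times path_weight_measurable branch_mass_measurable two_le_power_Suc_add)
  have "AE \<omega> in M. emeasure (\<mu> \<omega>) {?x} \<le> liminf (\<lambda>j. ennreal (Q j \<omega>))"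
    using cascade_facts(4) AE_space
  proof eventually_elim
    case (elim \<omega>)
    interpret \<mu>: finite_measure "\<mu> \<omega>" by (rule cascade_facts(2)[OF elim(2)])
    note [measurable_cong] = cascade_facts(1)[OF elim(2)]
    have bdd: "bounded (range h)" by (rule boundedI[of _ 1]) (use h01 in auto)
    then have "(\<lambda>N. \<integral>y. h y \<partial>cascade_approx \<gamma> X N \<omega>) \<longlonglongrightarrow> (\<integral>y. h y \<partial>\<mu> \<omega>)"
      using elim(1) h_cont unfolding weakly_converges_def by blast
    then have "(\<lambda>j. \<integral>y. h y \<partial>cascade_approx \<gamma> X (j + Suc n) \<omega>) \<longlonglongrightarrow> (\<integral>y. h y \<partial>\<mu> \<omega>)"
      by (rule LIMSEQ_ignore_initial_segment)
    then have "(\<lambda>j. \<integral>y. h y \<partial>cascade_approx \<gamma> X (Suc n + j) \<omega>) \<longlonglongrightarrow> (\<integral>y. h y \<partial>\<mu> \<omega>)"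
      by (simp only: add.commute)
    then have lim: "(\<lambda>j. ennreal (\<integral>y. h y \<partial>cascade_approx \<gamma> X (Suc n + j) \<omega>)) \<longlonglongrightarrow> ennreal (\<integral>y. h y \<partial>\<mu> \<omega>)"
      by (rule tendsto_ennrealI)
    have h_int: "integrable (\<mu> \<omega>) h"
      by (rule \<mu>.integrable_const_bound[where B = 1]) (use h01 in auto)
    have "emeasure (\<mu> \<omega>) {?x} = (\<integral>\<^sup>+y. indicator {?x} y \<partial>\<mu> \<omega>)"
      by (simp add: cascade_facts(1)[OF elim(2)])
    also have "\<dots> \<le> (\<integral>\<^sup>+y. ennreal (h y) \<partial>\<mu> \<omega>)"
      by (rule nn_integral_mono) (simp add: h_def indicator_def del: power_Suc)
    also have "\<dots> = ennreal (\<integral>y. h y \<partial>\<mu> \<omega>)"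
      using h_int h01 by (intro nn_integral_eq_integral) auto
    also have "\<dots> = liminf (\<lambda>j. ennreal (\<integral>y. h y \<partial>cascade_approx \<gamma> X (Suc n + j) \<omega>))"
      by (rule lim_imp_Liminf[OF _ lim, symmetric]) simp
    also have "\<dots> \<le> liminf (\<lambda>j. ennreal (Q j \<omega>))"
      unfolding h_def Q_def
      by (rule Liminf_mono, rule always_eventually, rule allI, rule ennreal_leI, rule tent_le_cells[OF K])
    finally show ?case .
  qed
  then have "(\<integral>\<^sup>+\<omega>. emeasure (\<mu> \<omega>) {?x} \<partial>M) \<le> (\<integral>\<^sup>+\<omega>. liminf (\<lambda>j. ennreal (Q j \<omega>)) \<partial>M)"
    by (rule nn_integral_mono_AE)
  also have "\<dots> \<le> liminf (\<lambda>j. \<integral>\<^sup>+\<omega>. ennreal (Q j \<omega>) \<partial>M)"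
    by (rule nn_integral_liminf) measurable
  also have "\<dots> = ennreal (real (card ?S) * (1 / 2) ^ Suc n)"
  proof -
    have "(\<integral>\<^sup>+\<omega>. ennreal (Q j \<omega>) \<partial>M) = ennreal (real (card ?S) * (1 / 2) ^ Suc n)" for j
      unfolding Q_def by (rule nn_integral_cells) auto
    then show ?thesis by (simp only: Liminf_const[OF trivial_limit_sequentially])
  qed
  also have "\<dots> \<le> ennreal (2 * (1 / 2) ^ Suc n)"
  proof (rule ennreal_leI, rule mult_right_mono)
    have "?S \<subseteq> {K, K - 1}" by auto
    then have "card ?S \<le> card {K, K - 1}" by (intro card_mono) auto
    also have "\<dots> \<le> 2" by (simp add: card_insert_if)
    finally show "real (card ?S) \<le> 2" by simp
  qed simp
  finally show ?thesis .
qed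

lemma no_dyadic_atoms:
  assumes K: "K \<le> 2 ^ n"
  shows "AE \<omega> in M. measure (\<mu> \<omega>) {real K / 2 ^ n} = 0"
proof -
  let ?x = "real K / 2 ^ n"
  let ?I = "\<integral>\<^sup>+\<omega>. emeasure (\<mu> \<omega>) {?x} \<partial>M"
  have "?I \<le> ennreal (2 * (1 / 2) ^ Suc (n + d))" for d
  proof -
    have "K * 2 ^ Suc d \<le> 2 ^ n * 2 ^ Suc d" using K by (rule mult_right_mono) simp
    then have K': "K * 2 ^ Suc d \<le> 2 ^ Suc (n + d)" by (simp add: power_add mult_ac)
    have "real (K * 2 ^ Suc d) / 2 ^ Suc (n + d) = ?x" by (simp add: power_add field_simps)
    with no_dyadic_atom_bound[OF K'] show ?thesis by (simp only:)
  qed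
  moreover have "(\<lambda>d. ennreal (2 * (1 / 2) ^ Suc (n + d))) \<longlonglongrightarrow> ennreal (2 * 0)"
  proof (intro tendsto_ennrealI tendsto_mult tendsto_const)
    have "(\<lambda>d. (1 / 2 :: real) ^ (d + Suc n)) \<longlonglongrightarrow> 0"
      by (rule LIMSEQ_ignore_initial_segment[OF LIMSEQ_power_zero]) simp
    then show "(\<lambda>d. (1 / 2 :: real) ^ Suc (n + d)) \<longlonglongrightarrow> 0" by (simp add: add.commute)
  qed
  ultimately have "?I \<le> ennreal (2 * 0)"
    by (intro LIMSEQ_le_const[where X = "\<lambda>d. ennreal (2 * (1 / 2) ^ Suc (n + d))"]) auto
  then have "?I = 0" by simp
  then have "AE \<omega> in M. emeasure (\<mu> \<omega>) {?x} = 0"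
    by (subst (asm) nn_integral_0_iff_AE) (auto intro: cascade_facts(3))
  then show ?thesis by eventually_elim (simp add: measure_def)
qed

text \<open>The exceptional null set serves all levels and positions at once because there are only countably many
  dyadic points.\<close>

lemma cascade_cells_limit:
  "AE \<omega> in M. \<forall>n. \<forall>k<2 ^ Suc n.
    (\<lambda>j. path_weight \<gamma> ((2 ^ Suc n + k) div 2) (env \<omega>) * branch_mass \<gamma> j (2 ^ Suc n + k) (env \<omega>))
      \<longlonglongrightarrow> measure (\<mu> \<omega>) (dyadic_interval (Suc n) k)"
proof -
  have "AE \<omega> in M. \<forall>n K. K \<le> 2 ^ n \<longrightarrow> measure (\<mu> \<omega>) {real K / 2 ^ n} = 0"
    unfolding AE_all_countable using no_dyadic_atoms by (auto simp: AE_conj_iff)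
  with cascade_facts(4) AE_space show ?thesis
  proof eventually_elim
    case (elim \<omega>)
    show ?case
    proof (intro allI impI)
      fix n k :: nat assume k: "k < 2 ^ Suc n"
      have "measure (\<mu> \<omega>) {real k / 2 ^ Suc n} = 0" "measure (\<mu> \<omega>) {real (Suc k) / 2 ^ Suc n} = 0"
        using elim(3) k by (meson less_imp_le Suc_leI)+
      moreover have "finite_measure (cascade_approx \<gamma> X N \<omega>)" if "N \<ge> 1" for N
        using that finite_measure_cascade_approx[of \<gamma> X "N - 1" \<omega>] by simp
      ultimately have "(\<lambda>N. measure (cascade_approx \<gamma> X N \<omega>) {real k / 2 ^ Suc n..<real (Suc k) / 2 ^ Suc n})
          \<longlonglongrightarrow> measure (\<mu> \<omega>) {real k / 2 ^ Suc n..<real (Suc k) / 2 ^ Suc n}"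
        using elim cascade_facts(1,2) by (intro weakly_converges_ivl) auto
      moreover have "{real k / 2 ^ Suc n..<real (Suc k) / 2 ^ Suc n} = dyadic_interval (Suc n) k"
        by (simp add: dyadic_interval_def add.commute)
      ultimately have "(\<lambda>N. measure (cascade_approx \<gamma> X N \<omega>) (dyadic_interval (Suc n) k)) \<longlonglongrightarrow> measure (\<mu> \<omega>) (dyadic_interval (Suc n) k)"
        by (simp only:)
      then have "(\<lambda>j. measure (cascade_approx \<gamma> X (j + Suc n) \<omega>) (dyadic_interval (Suc n) k)) \<longlonglongrightarrow> measure (\<mu> \<omega>) (dyadic_interval (Suc n) k)"
        by (rule LIMSEQ_ignore_initial_segment)
      then show "(\<lambda>j. path_weight \<gamma> ((2 ^ Suc n + k) div 2) (env \<omega>) * branch_mass \<gamma> j (2 ^ Suc n + k) (env \<omega>))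
          \<longlonglongrightarrow> measure (\<mu> \<omega>) (dyadic_interval (Suc n) k)"
        unfolding measure_cascade_approx[OF k, symmetric] by (simp only: add.commute)
    qed
  qed
qed

end

section \<open>The quotient of masses of nested cells\<close>

lemma frequently_ge_limit:
  fixes f :: "nat \<Rightarrow> real"
  assumes "f \<longlonglongrightarrow> L" "\<exists>\<^sub>F j in sequentially. a \<le> f j"
  shows "a \<le> L"
proof (rule ccontr)
  assume "\<not> a \<le> L"
  then have "\<forall>\<^sub>F j in sequentially. f j < a" using assms(1) by (intro order_tendstoD(2)) auto
  then have "\<forall>\<^sub>F j in sequentially. \<not> a \<le> f j" by eventually_elim simp
  with assms(2) show False by (simp add: frequently_def)
qed

lemma frequently_le_limit:
  fixes f :: "nat \<Rightarrow> real"
  assumes "f \<longlonglongrightarrow> L" "\<exists>\<^sub>F j in sequentially. f j \<le> a"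
  shows "L \<le> a"
  using frequently_ge_limit[OF tendsto_minus[OF assms(1)], of "- a"] assms(2) by simp

text \<open>The reverse Fatou inequality for events, used to transfer the bounds for deep truncated trees to the limit
  measure.\<close>

lemma (in prob_space) prob_frequently_ge:
  assumes E: "\<And>j. E j \<in> events" and ge: "\<forall>j\<ge>J. a \<le> prob (E j)"
    and A: "A \<in> events" and sub: "AE \<omega> in M. (\<exists>\<^sub>F j in sequentially. \<omega> \<in> E j) \<longrightarrow> \<omega> \<in> A"
  shows "a \<le> prob A"
proof -
  define B where "B = (\<lambda>i. \<Union>j\<in>{i..}. E j)"
  have B: "B i \<in> events" for i unfolding B_def using E by auto
  have "(\<lambda>i. prob (B i)) \<longlonglongrightarrow> prob (\<Inter>i. B i)"
  proof (rule finite_Lim_measure_decseq)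
    show "range B \<subseteq> events" using B by auto
    show "decseq B" unfolding B_def decseq_def by (intro allI impI UN_mono) auto
  qed
  moreover have "a \<le> prob (B i)" for i
  proof -
    have "a \<le> prob (E (max i J))" using ge by simp
    also have "\<dots> \<le> prob (B i)" by (rule finite_measure_mono[OF _ B]) (auto simp: B_def intro!: bexI[of _ "max i J"])
    finally show ?thesis .
  qed
  ultimately have "a \<le> prob (\<Inter>i. B i)" by (intro LIMSEQ_le_const) auto
  also have "\<dots> \<le> prob A"
  proof (rule finite_measure_mono_AE[OF _ A])
    show "AE \<omega> in M. \<omega> \<in> (\<Inter>i. B i) \<longrightarrow> \<omega> \<in> A"
      using sub by eventually_elim (auto simp: B_def frequently_sequentially)
  qed
  finally show ?thesis .
qed

lemma dyadic_ratio_image: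
  "(\<lambda>y. f (dyadic_interval_of n y) (dyadic_interval_of (Suc n) y)) ` {0..<1}
    = (\<lambda>k. f (dyadic_interval n (k div 2)) (dyadic_interval (Suc n) k)) ` {..<2 ^ Suc n}"
proof -
  have parent: "nat \<lfloor>2 ^ n * y\<rfloor> = nat \<lfloor>2 ^ Suc n * y\<rfloor> div 2" for y :: real
    unfolding floor_dyadic_parent[of n y] by (simp add: nat_div_distrib)
  have idx: "(\<lambda>y::real. nat \<lfloor>2 ^ Suc n * y\<rfloor>) ` {0..<1} = {..<2 ^ Suc n}"
  proof (intro equalityI subsetI)
    fix k assume "k \<in> {..<2 ^ Suc n :: nat}"
    then have k: "k < 2 ^ Suc n" by simp
    let ?y = "real k / 2 ^ Suc n"
    have idx: "k = nat \<lfloor>2 ^ Suc n * ?y\<rfloor>" by simp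
    have "?y \<in> dyadic_interval (Suc n) k" by (simp add: dyadic_interval_def divide_strict_right_mono)
    then have "?y \<in> {0..<1}" using dyadic_interval_subset[OF k] by blast
    with idx show "k \<in> (\<lambda>y::real. nat \<lfloor>2 ^ Suc n * y\<rfloor>) ` {0..<1}" by (rule image_eqI)
  next
    fix k assume "k \<in> (\<lambda>y::real. nat \<lfloor>2 ^ Suc n * y\<rfloor>) ` {0..<1}"
    then show "k \<in> {..<2 ^ Suc n}" using dyadic_interval_of_eq(3)[of _ "Suc n"] by blast
  qed
  have "(\<lambda>y. f (dyadic_interval_of n y) (dyadic_interval_of (Suc n) y)) ` {0..<1}
      = (\<lambda>y::real. f (dyadic_interval n (nat \<lfloor>2 ^ Suc n * y\<rfloor> div 2)) (dyadic_interval (Suc n) (nat \<lfloor>2 ^ Suc n * y\<rfloor>))) ` {0..<1}"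
    by (intro image_cong refl) (simp only: dyadic_interval_of_eq(2) parent)
  also have "\<dots> = (\<lambda>k. f (dyadic_interval n (k div 2)) (dyadic_interval (Suc n) k)) ` {..<2 ^ Suc n}"
    unfolding idx[symmetric] image_image ..
  finally show ?thesis .
qed

lemma ratio_lower_bound:
  fixes W t K \<eta> m m1 :: real
  assumes "0 < W" "0 < K" "0 < \<eta>" "\<eta> < 1" "W * t \<le> m" "W / 8 \<le> m1" "m1 \<le> W * K" "exp (- b * n) \<le> W" "0 < t"
  shows "exp (- (\<eta> * b * n)) * t * K powr (\<eta> - 1) \<le> m / m1 powr (1 - \<eta>)"
proof -
  have m1: "m1 > 0" using assms by linarith
  have "exp (- (\<eta> * b * n)) = exp (- b * n) powr \<eta>"
    by (simp add: powr_def mult_ac)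
  also have "\<dots> \<le> W powr \<eta>" using assms by (intro powr_mono2) auto
  finally have "exp (- (\<eta> * b * n)) * t * K powr (\<eta> - 1) \<le> W powr \<eta> * t * K powr (\<eta> - 1)"
    using assms by (intro mult_right_mono) auto
  also have "\<dots> = W * t / (W * K) powr (1 - \<eta>)"
  proof -
    have "W powr \<eta> = W powr 1 / W powr (1 - \<eta>)" unfolding powr_diff[symmetric] by simp
    moreover have "K powr (\<eta> - 1) = 1 / K powr (1 - \<eta>)"
      using powr_minus_divide[of K "1 - \<eta>"] by simp
    ultimately show ?thesis using assms by (simp add: powr_mult)
  qed
  also have "\<dots> \<le> m / m1 powr (1 - \<eta>)"
    using assms m1 by (intro frac_le powr_mono2 mult_nonneg_nonneg) (auto intro: order_trans[OF _ assms(5)])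
  finally show ?thesis .
qed

context dyadic_cascade
begin

definition good_level :: "real \<Rightarrow> real \<Rightarrow> real \<Rightarrow> nat \<Rightarrow> nat \<Rightarrow> 'w set" where
  "good_level b c K n j = {\<omega> \<in> space M. \<exists>v\<in>{2 ^ n..<2 ^ Suc n}.
      exp (- b * real n) \<le> path_weight \<gamma> v (env \<omega>) \<and> exp (c * real n) < branch_mass \<gamma> j (2 * v) (env \<omega>) \<and>
      1 / 8 < branch_mass \<gamma> j (Suc (2 * v)) (env \<omega>) \<and> branch_mass \<gamma> j (Suc (2 * v)) (env \<omega>) \<le> K}"

lemma good_level_event:
  assumes "n \<ge> 1" shows "good_level b c K n j \<in> events"
proof -
  have "v \<ge> 2" if "v \<in> {2 ^ n..<2 ^ Suc n}" for v :: nat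
    using that assms power_increasing[of 1 n "2::nat"] by auto
  then have [measurable]: "(\<lambda>\<omega>. branch_mass \<gamma> j (2 * v) (env \<omega>)) \<in> borel_measurable M"
    "(\<lambda>\<omega>. branch_mass \<gamma> j (Suc (2 * v)) (env \<omega>)) \<in> borel_measurable M" if "v \<in> {2 ^ n..<2 ^ Suc n}" for v
    using that by (auto intro!: branch_mass_measurable simp: trans_le_add1 mult_2)
  note [measurable] = path_weight_measurable
  show ?thesis unfolding good_level_def by measurable
qed

text \<open>There are only finitely many vertices of level \<open>n\<close>, so if some vertex is good for infinitely many depths, then a
  fixed one is, and its inequalities survive in the limit.\<close>

lemma large_ratio_of_good_level:
  assumes \<eta>: "0 < \<eta>" "\<eta> < 1" and K: "K > 0"
    and limit: "\<And>k. k < 2 ^ Suc n \<Longrightarrow>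
      (\<lambda>j. path_weight \<gamma> ((2 ^ Suc n + k) div 2) (env \<omega>) * branch_mass \<gamma> j (2 ^ Suc n + k) (env \<omega>))
        \<longlonglongrightarrow> measure (\<mu> \<omega>) (dyadic_interval (Suc n) k)"
    and often: "\<exists>\<^sub>F j in sequentially. \<omega> \<in> good_level b c K n j"
  shows "\<exists>k<2 ^ Suc n. exp ((c - \<eta> * b) * real n) * K powr (\<eta> - 1)
    \<le> measure (\<mu> \<omega>) (dyadic_interval n (k div 2)) / measure (\<mu> \<omega>) (dyadic_interval (Suc n) k) powr (1 - \<eta>)"
proof -
  let ?P = "\<lambda>v j. exp (- b * real n) \<le> path_weight \<gamma> v (env \<omega>) \<and> exp (c * real n) < branch_mass \<gamma> j (2 * v) (env \<omega>) \<and>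
      1 / 8 < branch_mass \<gamma> j (Suc (2 * v)) (env \<omega>) \<and> branch_mass \<gamma> j (Suc (2 * v)) (env \<omega>) \<le> K"
  have "\<exists>\<^sub>F j in sequentially. \<exists>v\<in>{2 ^ n..<2 ^ Suc n}. ?P v j"
    using often by (rule frequently_elim1) (simp add: good_level_def)
  then have "\<exists>v\<in>{2 ^ n..<2 ^ Suc n}. \<exists>\<^sub>F j in sequentially. ?P v j"
    by (rule frequently_bex_finite[OF finite_atLeastLessThan])
  then obtain v where v: "v \<in> {2 ^ n..<2 ^ Suc n}" and freq: "\<exists>\<^sub>F j in sequentially. ?P v j"
    by blast
  have \<omega>: "\<omega> \<in> space M" using often by (auto simp: good_level_def dest: frequently_ex)
  define u where "u = v - 2 ^ n"
  have v_eq: "v = 2 ^ n + u" and u: "u < 2 ^ n" using v by (auto simp: u_def)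
  define W where "W = path_weight \<gamma> v (env \<omega>)"
  have W: "W > 0" by (simp add: W_def)
  have idx: "2 ^ Suc n + 2 * u = 2 * v" "2 ^ Suc n + Suc (2 * u) = Suc (2 * v)" by (simp_all add: v_eq)
  have div: "2 * v div 2 = v" "Suc (2 * v) div 2 = v" by simp_all
  have lim0: "(\<lambda>j. W * branch_mass \<gamma> j (2 * v) (env \<omega>)) \<longlonglongrightarrow> measure (\<mu> \<omega>) (dyadic_interval (Suc n) (2 * u))"
    using limit[of "2 * u"] u unfolding idx div W_def by simp
  have lim1: "(\<lambda>j. W * branch_mass \<gamma> j (Suc (2 * v)) (env \<omega>)) \<longlonglongrightarrow> measure (\<mu> \<omega>) (dyadic_interval (Suc n) (Suc (2 * u)))"
    using limit[of "Suc (2 * u)"] u unfolding idx div W_def by simp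
  have m0: "W * exp (c * real n) \<le> measure (\<mu> \<omega>) (dyadic_interval (Suc n) (2 * u))"
    using W by (intro frequently_ge_limit[OF lim0] frequently_elim1[OF freq]) auto
  have m1: "W / 8 \<le> measure (\<mu> \<omega>) (dyadic_interval (Suc n) (Suc (2 * u)))"
    using W by (intro frequently_ge_limit[OF lim1] frequently_elim1[OF freq]) auto
  have m1': "measure (\<mu> \<omega>) (dyadic_interval (Suc n) (Suc (2 * u))) \<le> W * K"
    using W by (intro frequently_le_limit[OF lim1] frequently_elim1[OF freq]) auto
  have Wb: "exp (- b * real n) \<le> W"
    using frequently_ex[OF freq] by (auto simp: W_def)
  interpret \<mu>: finite_measure "\<mu> \<omega>" by (rule cascade_facts(2)[OF \<omega>])
  have "measure (\<mu> \<omega>) (dyadic_interval (Suc n) (2 * u)) \<le> measure (\<mu> \<omega>) (dyadic_interval n u)"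
    by (rule \<mu>.finite_measure_mono) (auto simp: dyadic_interval_split(1)[of n u] cascade_facts(1)[OF \<omega>])
  with m0 have m: "W * exp (c * real n) \<le> measure (\<mu> \<omega>) (dyadic_interval n u)" by linarith
  have "exp (- (\<eta> * b * real n)) * exp (c * real n) * K powr (\<eta> - 1)
    \<le> measure (\<mu> \<omega>) (dyadic_interval n u) / measure (\<mu> \<omega>) (dyadic_interval (Suc n) (Suc (2 * u))) powr (1 - \<eta>)"
    by (rule ratio_lower_bound[OF W K \<eta> m m1 m1' Wb]) simp
  moreover have "exp (- (\<eta> * b * real n)) * exp (c * real n) = exp ((c - \<eta> * b) * real n)"
    by (simp add: exp_add[symmetric] algebra_simps)
  ultimately have "exp ((c - \<eta> * b) * real n) * K powr (\<eta> - 1)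
    \<le> measure (\<mu> \<omega>) (dyadic_interval n (Suc (2 * u) div 2)) / measure (\<mu> \<omega>) (dyadic_interval (Suc n) (Suc (2 * u))) powr (1 - \<eta>)"
    by simp
  moreover have "Suc (2 * u) < 2 ^ Suc n" using u by simp
  ultimately show ?thesis by blast
qed

lemma ratio_event:
  "{\<omega> \<in> space M. \<exists>k<2 ^ Suc n. R \<le> measure (\<mu> \<omega>) (dyadic_interval n (k div 2)) /
      measure (\<mu> \<omega>) (dyadic_interval (Suc n) k) powr (1 - \<eta>)} \<in> events"
proof -
  have [measurable]: "(\<lambda>\<omega>. measure (\<mu> \<omega>) (dyadic_interval m k)) \<in> borel_measurable M" for m k
    unfolding measure_def using cascade_facts(3)[OF dyadic_interval_borel] by measurable
  show ?thesis by measurable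
qed

lemma ratio_probability_limit:
  assumes "\<gamma> > 0" "\<gamma>\<^sup>2 < 2 * ln 2" "0 < \<eta>" "\<eta> < \<gamma>\<^sup>2 / (\<gamma>\<^sup>2 + 2 * ln 2)"
  shows "(\<lambda>n. prob {\<omega> \<in> space M. \<exists>k<2 ^ Suc n. R \<le> measure (\<mu> \<omega>) (dyadic_interval n (k div 2)) /
      measure (\<mu> \<omega>) (dyadic_interval (Suc n) k) powr (1 - \<eta>)}) \<longlonglongrightarrow> 1"
    (is "(\<lambda>n. prob (?A n)) \<longlonglongrightarrow> 1")
proof -
  have "ln 2 > (0::real)" by simp
  then have den: "\<gamma>\<^sup>2 + 2 * ln 2 > 0" by (intro add_nonneg_pos) auto
  have "\<gamma>\<^sup>2 / (\<gamma>\<^sup>2 + 2 * ln 2) < 1" using den \<open>ln 2 > (0::real)\<close> by (simp add: pos_divide_less_eq)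
  then have \<eta>1: "\<eta> < 1" using assms by linarith
  have "\<eta> * (\<gamma>\<^sup>2 + 2 * ln 2) < \<gamma>\<^sup>2" using assms den by (simp only: pos_less_divide_eq)
  then have "\<eta> * (\<gamma>\<^sup>2 / 2 + ln 2) < \<gamma>\<^sup>2 / 2" by (simp add: algebra_simps)
  \<comment> \<open>This is where the bound on \<open>\<eta>\<close> enters: the window for the growth rate \<open>c\<close> is nonempty.\<close>
  then obtain c where c: "\<eta> * (\<gamma>\<^sup>2 / 2 + ln 2) < c" "c < \<gamma>\<^sup>2 / 2" using dense by blast
  have "\<gamma>\<^sup>2 / 2 + ln 2 < c / \<eta>" using c assms by (simp add: pos_less_divide_eq mult.commute)
  then obtain b where b: "\<gamma>\<^sup>2 / 2 + ln 2 < b" "b < c / \<eta>" using dense by blast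
  have \<eta>b: "\<eta> * b < c" using b assms by (simp add: pos_less_divide_eq mult.commute)
  have "0 < \<eta> * (\<gamma>\<^sup>2 / 2 + ln 2)" using assms den by (intro mult_pos_pos) auto
  then have "0 < c" using c by linarith
  obtain K lo where K: "K > 0" and lo: "lo \<longlonglongrightarrow> 1"
    and good: "\<forall>n\<ge>1. \<exists>J. \<forall>j\<ge>J. lo n \<le> prob (good_level b c K n j)"
    using good_vertex_probability[OF assms(1,2) b(1) \<open>0 < c\<close> c(2)] unfolding good_level_def[symmetric] .
  have "filterlim (\<lambda>n. (c - \<eta> * b) * real n) at_top sequentially"
    using \<eta>b by (intro filterlim_tendsto_pos_mult_at_top[OF tendsto_const] filterlim_real_sequentially) auto
  then have "filterlim (\<lambda>n. exp ((c - \<eta> * b) * real n)) at_top sequentially"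
    by (rule filterlim_compose[OF exp_at_top])
  then have "filterlim (\<lambda>n. K powr (\<eta> - 1) * exp ((c - \<eta> * b) * real n)) at_top sequentially"
    using K by (intro filterlim_tendsto_pos_mult_at_top[OF tendsto_const]) auto
  then have "\<forall>\<^sub>F n in sequentially. R \<le> K powr (\<eta> - 1) * exp ((c - \<eta> * b) * real n)"
    by (simp add: filterlim_at_top)
  then have "\<forall>\<^sub>F n in sequentially. lo n \<le> prob (?A n)"
    using eventually_ge_at_top[of 1]
  proof eventually_elim
    case (elim n)
    obtain J where J: "\<forall>j\<ge>J. lo n \<le> prob (good_level b c K n j)" using good elim by blast
    show ?case
    proof (rule prob_frequently_ge[OF good_level_event[OF elim(2)] J ratio_event])
      show "AE \<omega> in M. (\<exists>\<^sub>F j in sequentially. \<omega> \<in> good_level b c K n j) \<longrightarrow> \<omega> \<in> ?A n"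
        using cascade_cells_limit AE_space
      proof eventually_elim
        case e: (elim \<omega>)
        show ?case
        proof
          assume often: "\<exists>\<^sub>F j in sequentially. \<omega> \<in> good_level b c K n j"
          obtain k where k: "k < 2 ^ Suc n" "exp ((c - \<eta> * b) * real n) * K powr (\<eta> - 1)
              \<le> measure (\<mu> \<omega>) (dyadic_interval n (k div 2)) / measure (\<mu> \<omega>) (dyadic_interval (Suc n) k) powr (1 - \<eta>)"
            using large_ratio_of_good_level[OF assms(3) \<eta>1 K e(1)[rule_format] often] by blast
          from k(2) elim(1) have "R \<le> measure (\<mu> \<omega>) (dyadic_interval n (k div 2)) / measure (\<mu> \<omega>) (dyadic_interval (Suc n) k) powr (1 - \<eta>)"
            by (simp only: mult.commute)
          with k(1) e(2) show "\<omega> \<in> ?A n" by blast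
        qed
      qed
    qed
  qed
  moreover have "\<forall>\<^sub>F n in sequentially. prob (?A n) \<le> 1" by simp
  ultimately show ?thesis by (intro tendsto_sandwich[OF _ _ lo tendsto_const])
qed

end

theorem theoremA3:
  fixes M :: "'w measure"
    and X :: "nat \<times> real \<Rightarrow> 'w \<Rightarrow> real"
    and \<mu> :: "'w \<Rightarrow> real measure"
    and \<gamma> \<eta> :: real
  assumes "prob_space M"
    and "\<gamma> > 0" and "\<gamma>\<^sup>2 < 2 * ln 2"
    and "prob_space.indep_vars M (\<lambda>_. borel) X dyadic_nodes"
    and "\<And>v. v \<in> dyadic_nodes \<Longrightarrow> distributed M lborel (X v) std_normal_density"
    and "cascade_measure M \<gamma> X \<mu>"
    and "0 < \<eta>" and "\<eta> < \<gamma>\<^sup>2 / (\<gamma>\<^sup>2 + 2 * ln 2)"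
  shows "\<forall>R>0. (\<lambda>n. measure M {\<omega> \<in> space M.
      Max ((\<lambda>y. measure (\<mu> \<omega>) (dyadic_interval_of n y) /
             measure (\<mu> \<omega>) (dyadic_interval_of (Suc n) y) powr (1 - \<eta>)) ` {0..<1}) \<ge> R})
    \<longlonglongrightarrow> 1"
proof -
  interpret prob_space M by (rule assms(1))
  interpret dyadic_cascade M X \<mu> \<gamma>
    using assms by unfold_locales auto
  have "(Max ((\<lambda>y. measure (\<mu> \<omega>) (dyadic_interval_of n y) /
             measure (\<mu> \<omega>) (dyadic_interval_of (Suc n) y) powr (1 - \<eta>)) ` {0..<1}) \<ge> R)
      \<longleftrightarrow> (\<exists>k<2 ^ Suc n. R \<le> measure (\<mu> \<omega>) (dyadic_interval n (k div 2)) /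
      measure (\<mu> \<omega>) (dyadic_interval (Suc n) k) powr (1 - \<eta>))" for R n \<omega>
  proof -
    have ne: "{..<2 ^ Suc n :: nat} \<noteq> {}" by (simp add: lessThan_empty_iff)
    show ?thesis
      unfolding dyadic_ratio_image[of "\<lambda>I I'. measure (\<mu> \<omega>) I / measure (\<mu> \<omega>) I' powr (1 - \<eta>)" n]
      using ne by (subst Max_ge_iff) (auto simp del: power_Suc)
  qed
  then show ?thesis
    using ratio_probability_limit[OF assms(2,3,7,8)] by simp
qed

end
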